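(* Let $x_1,x_2,\dots$ be independent identically distributed random variables in $[0,1]$ with common probability density $f$ such that $f(x)$ is asymptotic to $c x^{\beta}$ as $x\to0^+$ (that is, $f(x)/(c x^{\beta})\to1$), where $c>0$, and let $\alpha=1+\beta$. Let $H_n$ be the harmonic mean of $x_1,\dots,x_n$ and $\mathcal E=\mathbf E(1/x_1)$. If $\alpha>1$ (that is, $\beta>0$), then the random variable $n^{1-1/\alpha}\left(H_n-\frac1{\mathcal E}\right)$ converges in distribution to a variable with distribution function $x\mapsto1-G(-x\mathcal E^2)$, where $G$ is the unbalanced stable distribution of exponent $\alpha$ (the limiting distribution of $Y_n=n^{1-1/\alpha}\left(\frac1{H_n}-\mathcal E\right)$).
   Context: The harmonic mean is given by $\frac1{H_n}=\frac1n\sum_{i=1}^n\frac1{x_i}$. A nondegenerate distribution $G$ is called stable of exponent $\alpha$ ($0<\alpha\le2$) if it is the limit in distribution of $n^{-1/\alpha}S_n-b_n$ for some real constants $b_n$ and some partial sums $S_n$ of i.i.d. random variables; $\alpha=2$ is the normal distribution. For $\alpha<2$ its tails satisfy $x^{\alpha}(1-G(x))\to Cp$, $x^{\alpha}G(-x)\to Cq$ as $x\to+\infty$, with $C>0$, $p,q\ge0$, $p+q=1$. The stable law is called unbalanced if $p=1$ or $q=1$, which is the case when the summands are positive, as the variables $1/x_i$ are here.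
   Formalization: The formal theorem assumes 1<α<2 rather than only α>1; for α≥2 the claim fails (e.g. f(x)=2x on [0,1], where the variance of 1/x is infinite and Y_n does not converge), and unbalanced stable laws are defined only for α<2. *)

theory Defs
  imports "HOL-Probability.Probability"
begin

text \<open>
  Sequences of random variables are indexed from 0, so the first \<open>n\<close> of them are \<open>i < n\<close>.
  If some \<open>x i = 0\<close> then \<open>1 / x i = 0\<close> by the library convention; for variables with
  a density this affects only a null set.
\<close>

definition harmonic_mean :: "nat \<Rightarrow> (nat \<Rightarrow> real) \<Rightarrow> real" where
  "harmonic_mean n x = 1 / (1 / real n * (\<Sum>i<n. 1 / x i))"

definition nondegenerate :: "real measure \<Rightarrow> bool" where
  "nondegenerate G \<longleftrightarrow> \<not> (\<exists>a. measure G {a} = 1)"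

text \<open>
  The summands live on some probability space over the type \<open>nat \<Rightarrow> real\<close>. This
  is no restriction: an i.i.d. sequence on any space has the same joint law as the coordinate
  sequence on the product space.
\<close>

definition stable_law :: "real \<Rightarrow> real measure \<Rightarrow> bool" where
  "stable_law \<alpha> G \<longleftrightarrow>
     0 < \<alpha> \<and> \<alpha> \<le> 2 \<and> real_distribution G \<and> nondegenerate G \<and>
     (\<exists>(M :: (nat \<Rightarrow> real) measure) (X :: nat \<Rightarrow> (nat \<Rightarrow> real) \<Rightarrow> real) (b :: nat \<Rightarrow> real).
        prob_space M \<and>
        prob_space.indep_vars M (\<lambda>_. borel) X UNIV \<and>
        (\<forall>i. distr M borel (X i) = distr M borel (X 0)) \<and>
        weak_conv_m
          (\<lambda>n. distr M borel (\<lambda>\<omega>. real n powr (- 1 / \<alpha>) * (\<Sum>i<n. X i \<omega>) - b n)) G)"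

definition unbalanced_stable_law :: "real \<Rightarrow> real measure \<Rightarrow> bool" where
  "unbalanced_stable_law \<alpha> G \<longleftrightarrow>
     stable_law \<alpha> G \<and> \<alpha> < 2 \<and>
     (\<exists>C p q. C > 0 \<and> p \<ge> 0 \<and> q \<ge> 0 \<and> p + q = 1 \<and>
        ((\<lambda>x. x powr \<alpha> * (1 - cdf G x)) \<longlongrightarrow> C * p) at_top \<and>
        ((\<lambda>x. x powr \<alpha> * cdf G (- x)) \<longlongrightarrow> C * q) at_top \<and>
        (p = 1 \<or> q = 1))"

end

theory Submission
  imports Defs "HOL-Real_Asymp.Real_Asymp"
begin

text \<open>
  Put \<open>Y = 1 / X 0\<close> and \<open>k x = iexp x - 1 - \<i> x\<close>. Since \<open>f x\<close> behaves like \<open>c x powr \<beta>\<close> at \<open>0\<close>,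
  rescaling \<open>x = v / n powr (1 / \<alpha>)\<close> and dominated convergence turn \<open>n E (k (s Y / n powr (1 / \<alpha>)))\<close> into
  \<open>\<psi> s\<close>, the integral of \<open>k (s / v) c v powr \<beta>\<close> over \<open>v > 0\<close>, so the normalised sums of the reciprocals have
  characteristic functions tending to \<open>exp \<psi>\<close>. A limit law \<open>G\<close> then exists by tightness and Helly selection.

  Averaging increments of a characteristic function over a standard normal variable weights the measure by
  \<open>1 - exp (- y\<^sup>2 / 2)\<close>. This one identity gives the tightness, the absence of atoms of \<open>G\<close>, and the
  tails: by the scaling of \<open>\<psi>\<close>, \<open>x powr \<alpha>\<close> times the law of \<open>Z / x\<close>, with \<open>Z\<close> distributed as \<open>G\<close>, converges
  after weighting to the weighted Levy measure, which is carried by the positive half-line.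

  The harmonic mean is the reciprocal of \<open>\<E> + n powr (1 / \<alpha> - 1) Z\<^sub>n\<close>, where \<open>Z\<^sub>n\<close> are the normalised sums,
  so its limit law follows from the delta method; atomlessness of \<open>G\<close> gives the stated distribution function.
\<close>

subsection \<open>Gaussian averages of characteristic functions\<close>

lemma prob_space_std_normal: "prob_space std_normal_distribution"
  by (rule prob_space_normal_density) simp

lemma integral_one_minus_iexp_gaussian:
  "(CLINT h|std_normal_distribution. 1 - iexp (t * h)) = complex_of_real (1 - exp (- t\<^sup>2 / 2))"
proof -
  interpret N: prob_space std_normal_distribution by (rule prob_space_std_normal)
  have "(CLINT h|std_normal_distribution. 1 - iexp (t * h)) = 1 - char std_normal_distribution t"
    unfolding char_def
    by (subst Bochner_Integration.integral_diff) (auto intro!: N.integrable_iexp simp: N.prob_space[simplified])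
  then show ?thesis by (simp add: char_std_normal_distribution)
qed

text \<open>By Fubini, with the normal average over \<open>h\<close> taken first. The resulting
  weight is bounded, quadratically small at 0 and bounded below away from 0. The case
  \<open>s = 0\<close> controls tails and atoms, the case \<open>u = 1\<close> gives the
  characteristic functions of weighted laws.\<close>

lemma (in real_distribution) char_gaussian_increment:
  "(CLINT h|std_normal_distribution. char M s - char M (s + u * h)) =
   (CLINT x|M. (1 - exp (- (u * x)\<^sup>2 / 2)) *\<^sub>R iexp (s * x))"
proof -
  interpret N: prob_space std_normal_distribution by (rule prob_space_std_normal)
  interpret P: pair_prob_space std_normal_distribution M ..
  have int: "integrable (std_normal_distribution \<Otimes>\<^sub>M M)
      (\<lambda>(h, x). iexp (s * x) - iexp ((s + u * h) * x))"
    by (rule P.integrable_const_bound[where B = 2])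
       (auto intro!: AE_I2 order_trans[OF norm_triangle_ineq4] simp del: of_real_mult of_real_add)
  have "(CLINT h|std_normal_distribution. char M s - char M (s + u * h)) =
      (CLINT h|std_normal_distribution. CLINT x|M. iexp (s * x) - iexp ((s + u * h) * x))"
    unfolding char_def
    by (intro Bochner_Integration.integral_cong refl Bochner_Integration.integral_diff[symmetric]
          integrable_iexp) auto
  also have "\<dots> = (CLINT x|M. CLINT h|std_normal_distribution.
      iexp (s * x) - iexp ((s + u * h) * x))"
    by (rule P.Fubini_integral[symmetric]) (rule int)
  also have "\<dots> = (CLINT x|M. (1 - exp (- (u * x)\<^sup>2 / 2)) *\<^sub>R iexp (s * x))"
  proof (intro Bochner_Integration.integral_cong refl)
    fix x :: real
    have "(CLINT h|std_normal_distribution. iexp (s * x) - iexp ((s + u * h) * x)) =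
        (CLINT h|std_normal_distribution. iexp (s * x) * (1 - iexp (u * x * h)))"
      by (simp add: algebra_simps exp_add)
    also have "\<dots> = iexp (s * x) * (CLINT h|std_normal_distribution. 1 - iexp (u * x * h))"
      by (rule integral_mult_right_zero)
    also note integral_one_minus_iexp_gaussian
    finally show "(CLINT h|std_normal_distribution. iexp (s * x) - iexp ((s + u * h) * x)) =
        (1 - exp (- (u * x)\<^sup>2 / 2)) *\<^sub>R iexp (s * x)"
      by (simp add: scaleR_conv_of_real mult.commute)
  qed
  finally show ?thesis .
qed

lemma one_minus_exp_half_ge: "1 \<le> \<bar>y\<bar> \<Longrightarrow> 1 / 4 \<le> 1 - exp (- y\<^sup>2 / 2 :: real)"
proof -
  assume "1 \<le> \<bar>y\<bar>"
  then have "1 \<le> y\<^sup>2" by (metis abs_ge_zero one_le_power power2_abs)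
  \<comment> \<open>This yields the lower bound 1/3, rounded down to 1/4.\<close>
  then have "3/2 \<le> 1 + y\<^sup>2 / 2" by simp
  also have "\<dots> \<le> exp (y\<^sup>2 / 2)" by (rule exp_ge_add_one_self)
  finally have "3/2 \<le> exp (y\<^sup>2 / 2)" .
  then have "exp (- (y\<^sup>2 / 2)) \<le> 1 / (3/2)" unfolding exp_minus inverse_eq_divide by (intro divide_left_mono) auto
  then show ?thesis by simp
qed

text \<open>A Markov inequality: 4 is the reciprocal of the lower bound in
  \<open>one_minus_exp_half_ge\<close>, and the mean of the weight is a Gaussian average of
  increments of the characteristic function at 0.\<close>

lemma (in real_distribution) measure_tail_le_char:
  assumes "0 < u"
  shows "measure M {x. 1 \<le> \<bar>u * x\<bar>} \<le>
    4 * cmod (CLINT h|std_normal_distribution. 1 - char M (u * h))"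
proof -
  have "(LINT x|M. indicator {x. 1 \<le> \<bar>u * x\<bar>} x) \<le> (LINT x|M. 4 * (1 - exp (- (u * x)\<^sup>2 / 2)))"
  proof (rule integral_mono)
    show "integrable M (\<lambda>x. 4 * (1 - exp (- (u * x)\<^sup>2 / 2)))"
      by (rule integrable_const_bound[where B = 4]) auto
    show "indicator {x. 1 \<le> \<bar>u * x\<bar>} x \<le> 4 * (1 - exp (- (u * x)\<^sup>2 / 2))" for x
      using one_minus_exp_half_ge[of "u * x"] by (auto split: split_indicator)
  qed (auto intro!: integrable_const_bound[where B = 1])
  also have "(LINT x|M. 4 * (1 - exp (- (u * x)\<^sup>2 / 2))) = 4 * (LINT x|M. 1 - exp (- (u * x)\<^sup>2 / 2))"
    by (rule integral_mult_right_zero)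
  also have "(LINT x|M. 1 - exp (- (u * x)\<^sup>2 / 2)) \<le>
      cmod (CLINT x|M. (1 - exp (- (u * x)\<^sup>2 / 2)) *\<^sub>R iexp (0 * x))"
    by (simp add: scaleR_conv_of_real flip: of_real_diff)
  also have "\<dots> = cmod (CLINT h|std_normal_distribution. char M 0 - char M (0 + u * h))"
    by (subst char_gaussian_increment) simp
  finally show ?thesis by (simp add: char_zero)
qed

lemma (in real_distribution) measure_interval_tendsto_1:
  "(\<lambda>k. measure M {- real k<..real k}) \<longlonglongrightarrow> 1"
proof -
  have *: "(\<Union>k::nat. {- real k<..real k}) = UNIV"
    by (auto, metis leI le_less_trans less_imp_le minus_less_iff reals_Archimedean2)
  have "(\<lambda>k. measure M {- real k<..real k}) \<longlonglongrightarrow> measure M (\<Union>k::nat. {- real k<..real k})"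
    by (rule finite_Lim_measure_incseq) (auto simp: incseq_def)
  then show ?thesis using prob_space unfolding * by simp
qed

text \<open>Levy's continuity theorem without knowing that \<open>\<phi>\<close> is a characteristic
  function. Continuity at 0 gives tightness, Helly selection gives a limit along a subsequence; its
  characteristic function must be \<open>\<phi>\<close>, and then the whole sequence
  converges.\<close>

lemma weak_conv_of_char_limit:
  fixes \<mu> :: "nat \<Rightarrow> real measure" and \<phi> :: "real \<Rightarrow> complex"
  assumes rd: "\<And>n. real_distribution (\<mu> n)"
    and lim: "\<And>t. (\<lambda>n. char (\<mu> n) t) \<longlonglongrightarrow> \<phi> t"
    and cont: "isCont \<phi> 0"
  shows "\<exists>G. real_distribution G \<and> char G = \<phi> \<and> weak_conv_m \<mu> G"
proof -
  interpret N: prob_space std_normal_distribution by (rule prob_space_std_normal)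
  interpret \<mu>: real_distribution "\<mu> n" for n by (rule rd)
  have bd: "cmod (\<phi> t) \<le> 1" for t
    by (rule tendsto_upperbound[OF tendsto_norm[OF lim]]) (auto simp: \<mu>.cmod_char_le_1)
  have \<phi>0: "\<phi> 0 = 1"
    using lim[of 0] by (simp add: \<mu>.char_zero LIMSEQ_const_iff)
  have [measurable]: "\<phi> \<in> borel_measurable borel"
    by (rule borel_measurable_LIMSEQ_metric[OF _ lim]) simp
  have "\<exists>a b. a < b \<and> (\<forall>n. 1 - \<epsilon> < measure (\<mu> n) {a<..b})" if \<epsilon>: "0 < \<epsilon>" for \<epsilon> :: real
  proof -
    \<comment> \<open>As the scale shrinks, continuity at 0 makes the average of
      \<open>1 - \<phi>\<close> small. A scale \<open>u\<close> is then fixed where it is below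
      \<open>\<epsilon> / 4\<close>, to absorb the factor 4 of the tail bound.\<close>
    have "(\<lambda>k. CLINT h|std_normal_distribution. 1 - \<phi> (1 / real (Suc k) * h))
        \<longlonglongrightarrow> (CLINT h|std_normal_distribution. 0)"
    proof (rule integral_dominated_convergence[where w = "\<lambda>_. 2"])
      show "AE h in std_normal_distribution. (\<lambda>k. 1 - \<phi> (1 / real (Suc k) * h)) \<longlonglongrightarrow> 0"
      proof (rule AE_I2)
        fix h :: real
        have "(\<lambda>k. 1 / real (Suc k) * h) \<longlonglongrightarrow> 0"
          using tendsto_mult_left_zero[OF LIMSEQ_inverse_real_of_nat, of h]
          by (simp add: inverse_eq_divide)
        then have "(\<lambda>k. 1 - \<phi> (1 / real (Suc k) * h)) \<longlonglongrightarrow> 1 - \<phi> 0"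
          by (intro tendsto_intros isCont_tendsto_compose[OF cont])
        then show "(\<lambda>k. 1 - \<phi> (1 / real (Suc k) * h)) \<longlonglongrightarrow> 0" by (simp add: \<phi>0)
      qed
    qed (auto intro!: order_trans[OF norm_triangle_ineq4] add_mono[of _ 1 _ 1, simplified] bd)
    then have "\<forall>\<^sub>F k in sequentially.
        cmod (CLINT h|std_normal_distribution. 1 - \<phi> (1 / real (Suc k) * h)) < \<epsilon> / 4"
      using \<epsilon> by (auto dest!: tendstoD[where e = "\<epsilon> / 4"])
    then obtain k where k: "cmod (CLINT h|std_normal_distribution. 1 - \<phi> (1 / real (Suc k) * h)) < \<epsilon> / 4"
      by (auto simp: eventually_sequentially)
    define u where "u = 1 / real (Suc k)"
    have u: "0 < u" by (simp add: u_def)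
    \<comment> \<open>At the fixed scale the averages for \<open>\<mu> n\<close> converge to that of
      \<open>\<phi>\<close>, so all but finitely many of the laws have small tails at once.\<close>
    have "(\<lambda>n. CLINT h|std_normal_distribution. 1 - char (\<mu> n) (u * h))
        \<longlonglongrightarrow> (CLINT h|std_normal_distribution. 1 - \<phi> (u * h))"
      by (rule integral_dominated_convergence[where w = "\<lambda>_. 2"])
         (auto intro!: order_trans[OF norm_triangle_ineq4] add_mono[of _ 1 _ 1, simplified]
            \<mu>.cmod_char_le_1 tendsto_intros lim)
    from order_tendstoD(2)[OF tendsto_norm[OF this] k[folded u_def]]
    have "\<forall>\<^sub>F n in sequentially. cmod (CLINT h|std_normal_distribution. 1 - char (\<mu> n) (u * h)) < \<epsilon> / 4" .
    then have ev: "\<forall>\<^sub>F n in sequentially. 1 - \<epsilon> < measure (\<mu> n) {x. \<bar>u * x\<bar> < 1}"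
    proof eventually_elim
      case (elim n)
      have "{x. \<bar>u * x\<bar> < 1} = space (\<mu> n) - {x. 1 \<le> \<bar>u * x\<bar>}" by auto
      then have "measure (\<mu> n) {x. \<bar>u * x\<bar> < 1} = 1 - measure (\<mu> n) {x. 1 \<le> \<bar>u * x\<bar>}"
        by (simp add: \<mu>.prob_compl del: \<mu>.space_eq_univ)
      then show ?case using \<mu>.measure_tail_le_char[OF u, of n] elim by linarith
    qed
    then obtain n0 where n0: "\<And>n. n0 \<le> n \<Longrightarrow> 1 - \<epsilon> < measure (\<mu> n) {x. \<bar>u * x\<bar> < 1}"
      by (auto simp: eventually_sequentially)
    have "\<forall>\<^sub>F j in sequentially. \<forall>n\<in>{..<n0}. 1 - \<epsilon> < measure (\<mu> n) {- real j<..real j}"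
      using \<epsilon> by (intro eventually_ball_finite)
        (auto intro!: order_tendstoD(1)[OF \<mu>.measure_interval_tendsto_1])
    then obtain j where j: "\<And>n. n < n0 \<Longrightarrow> 1 - \<epsilon> < measure (\<mu> n) {- real j<..real j}"
      by (auto simp: eventually_sequentially)
    \<comment> \<open>The first entry serves the finitely many laws with \<open>n < n0\<close>, each
      tight by itself; the second serves all others.\<close>
    define K where "K = max (real j) (1 / u)"
    have "1 - \<epsilon> < measure (\<mu> n) {-K<..K}" for n
    proof (cases "n < n0")
      case True
      then show ?thesis
        by (rule less_le_trans[OF j \<mu>.finite_measure_mono]) (auto simp: K_def)
    next
      case False
      have "{x. \<bar>u * x\<bar> < 1} \<subseteq> {-K<..K}"
      proof safe
        fix x assume "\<bar>u * x\<bar> < 1"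
        then have "\<bar>x\<bar> < 1 / u" using u by (simp add: abs_mult field_simps)
        then have "\<bar>x\<bar> < K" by (simp add: K_def)
        then show "x \<in> {-K<..K}" by auto
      qed
      with False show ?thesis
        by (intro less_le_trans[OF n0 \<mu>.finite_measure_mono]) auto
    qed
    moreover have "0 < K" using u by (simp add: K_def less_max_iff_disj)
    then have "- K < K" by simp
    ultimately show ?thesis by blast
  qed
  then have "tight \<mu>" using rd by (auto simp: tight_def)
  from tight_imp_convergent_subsubsequence[OF this strict_mono_id]
  obtain r G where r: "strict_mono r" and G: "real_distribution G" and wc: "weak_conv_m (\<mu> \<circ> id \<circ> r) G"
    by blast
  have ch: "char G t = \<phi> t" for t
  proof (rule LIMSEQ_unique)
    show "(\<lambda>n. char ((\<mu> \<circ> id \<circ> r) n) t) \<longlonglongrightarrow> char G t"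
      by (rule levy_continuity1[OF _ G wc]) (simp add: rd)
    show "(\<lambda>n. char ((\<mu> \<circ> id \<circ> r) n) t) \<longlonglongrightarrow> \<phi> t"
      using LIMSEQ_subseq_LIMSEQ[OF lim r] by (simp add: comp_def)
  qed
  moreover have "weak_conv_m \<mu> G"
    by (rule levy_continuity[OF rd G]) (simp add: ch lim)
  ultimately show ?thesis using G by blast
qed

subsection \<open>The stable exponent\<close>

text \<open>The derivative of \<open>exp\<close> has norm at most 1 on the left half-plane, which is
  convex.\<close>

lemma norm_exp_minus_one_le:
  fixes z :: complex
  assumes "Re z \<le> 0"
  shows "norm (exp z - 1) \<le> norm z"
proof -
  have "norm (exp z - exp 0) \<le> 1 * norm (z - 0)"
    by (rule field_differentiable_bound[where S = "{z. Re z \<le> 0}" and f' = exp])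
       (use assms in \<open>auto simp: convex_halfspace_Re_le intro!: derivative_eq_intros\<close>)
  then show ?thesis by simp
qed

text \<open>The Levy-Khintchine integrand with the whole linear term subtracted, of second order at
  0 and linear growth at infinity. It corresponds to centring at the mean, which is finite here
  because the exponent exceeds 1.\<close>

definition compensated_iexp :: "real \<Rightarrow> complex" where
  "compensated_iexp x = iexp x - 1 - \<i> * x"

lemma measurable_compensated_iexp [measurable]: "compensated_iexp \<in> borel_measurable borel"
  unfolding compensated_iexp_def by measurable

lemma norm_compensated_iexp_le_square: "norm (compensated_iexp x) \<le> x\<^sup>2 / 2"
  using iexp_approx1[of x 1] by (simp add: compensated_iexp_def diff_diff_eq numeral_2_eq_2)

lemma norm_compensated_iexp_le_abs: "norm (compensated_iexp x) \<le> 2 * \<bar>x\<bar>"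
  using iexp_approx2[of x 1] by (simp add: compensated_iexp_def diff_diff_eq)

text \<open>Separates \<open>s\<close> from \<open>v\<close>: one function of \<open>v\<close>
  dominates for every \<open>s\<close>, and the other factor gives the growth of
  \<open>\<psi>\<close>.\<close>

lemma norm_compensated_iexp_divide_le:
  assumes "0 < v"
  shows "norm (compensated_iexp (s / v)) \<le> 2 * (\<bar>s\<bar> + s\<^sup>2) * min (1 / v) (1 / v\<^sup>2)"
proof (cases "1 / v \<le> 1 / v\<^sup>2")
  case True
  have "norm (compensated_iexp (s / v)) \<le> 2 * \<bar>s\<bar> * (1 / v)"
    using norm_compensated_iexp_le_abs[of "s / v"] assms by simp
  also have "\<dots> \<le> 2 * (\<bar>s\<bar> + s\<^sup>2) * (1 / v)"
    using assms by (intro mult_right_mono) auto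
  finally show ?thesis using True by (simp add: min_def)
next
  case False
  have "norm (compensated_iexp (s / v)) \<le> s\<^sup>2 / 2 * (1 / v\<^sup>2)"
    using norm_compensated_iexp_le_square[of "s / v"] by (simp add: power_divide)
  also have "\<dots> \<le> 2 * (\<bar>s\<bar> + s\<^sup>2) * (1 / v\<^sup>2)"
    by (intro mult_right_mono) auto
  finally show ?thesis using False by (simp add: min_def)
qed

text \<open>
  The Levy measure of the limit law is \<open>c y powr (- 2 - \<beta>) dy\<close> on the positive half-line. It is
  used here in the coordinate \<open>v = 1 / y\<close>, in which it is \<open>c v powr \<beta> dv\<close>.
\<close>

definition recip_levy_measure :: "real \<Rightarrow> real \<Rightarrow> real measure" where
  "recip_levy_measure c \<beta> = density lborel (\<lambda>v. ennreal (indicator {0<..} v * (c * v powr \<beta>)))"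

text \<open>The logarithm of the characteristic function of the limit law, kept as an integral: its
  scaling and the sign of its real part are read off without a closed form.\<close>

definition stable_exponent :: "real \<Rightarrow> real \<Rightarrow> real \<Rightarrow> complex" where
  "stable_exponent c \<beta> s = (CLINT v|recip_levy_measure c \<beta>. compensated_iexp (s / v))"

text \<open>Below 1 the integrand is \<open>v powr (\<beta> - 1)\<close>, integrable at 0 as \<beta>
  > 0; above 1 it is \<open>v powr (\<beta> - 2)\<close>, integrable at infinity as \<beta> <
  1.\<close>

lemma integrable_power_min:
  fixes \<beta> :: real
  assumes "0 < \<beta>" "\<beta> < 1"
  shows "integrable lborel (\<lambda>v. indicator {0<..} v * v powr \<beta> * min (1 / v) (1 / v\<^sup>2))"
proof (rule Bochner_Integration.integrable_bound)
  have 1: "integrable lborel (\<lambda>v. indicator {0..1} v *\<^sub>R v powr (\<beta> - 1))"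
    using nonnegative_absolutely_integrable_1[OF integrable_on_powr_from_0[of "\<beta> - 1" 1]] assms
    by (simp add: set_integrable_def integrable_completion)
  have 2: "integrable lborel (\<lambda>v. indicator {1..} v *\<^sub>R v powr (\<beta> - 2))"
    using nonnegative_absolutely_integrable_1[OF has_integral_integrable[OF has_integral_powr_to_inf[of "\<beta> - 2" 1]]] assms
    by (simp add: set_integrable_def integrable_completion)
  show "integrable lborel (\<lambda>v. indicator {0..1} v *\<^sub>R v powr (\<beta> - 1) + indicator {1..} v *\<^sub>R v powr (\<beta> - 2))"
    by (rule Bochner_Integration.integrable_add[OF 1 2])
  show "AE v in lborel. norm (indicator {0<..} v * v powr \<beta> * min (1 / v) (1 / v\<^sup>2)) \<le>
    norm (indicator {0..1} v *\<^sub>R v powr (\<beta> - 1) + indicator {1..} v *\<^sub>R v powr (\<beta> - 2))"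
  proof (rule AE_I2)
    fix v :: real
    consider "v \<le> 0" | "0 < v" "v \<le> 1" | "1 < v" by linarith
    then show "norm (indicator {0<..} v * v powr \<beta> * min (1 / v) (1 / v\<^sup>2)) \<le>
      norm (indicator {0..1} v *\<^sub>R v powr (\<beta> - 1) + indicator {1..} v *\<^sub>R v powr (\<beta> - 2))"
    proof cases
      case 1 then show ?thesis by simp
    next
      case 2
      have "v powr \<beta> * min (1 / v) (1 / v\<^sup>2) \<le> v powr \<beta> * (1 / v)"
        by (intro mult_left_mono) auto
      also have "\<dots> = v powr (\<beta> - 1)" using 2 by (simp add: powr_diff)
      also have "\<dots> \<le> v powr (\<beta> - 1) + indicator {1..} v *\<^sub>R v powr (\<beta> - 2)" by simp
      finally show ?thesis using 2 by (simp add: min_def)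
    next
      case 3
      have "v powr \<beta> * min (1 / v) (1 / v\<^sup>2) \<le> v powr \<beta> * (1 / v\<^sup>2)"
        by (intro mult_left_mono) auto
      also have "\<dots> = v powr (\<beta> - 2)" using 3 by (simp add: powr_diff)
      finally show ?thesis using 3 by (simp add: min_def)
    qed
  qed
qed measurable

locale stable_parameters =
  fixes c \<beta> :: real
  assumes c_pos: "0 < c" and \<beta>_pos: "0 < \<beta>" and \<beta>_less_1: "\<beta> < 1"
begin

abbreviation "\<nu> \<equiv> recip_levy_measure c \<beta>"
abbreviation "\<psi> \<equiv> stable_exponent c \<beta>"

lemma sets_\<nu> [simp, measurable_cong]: "sets \<nu> = sets borel"
  by (simp add: recip_levy_measure_def)

lemma space_\<nu> [simp]: "space \<nu> = UNIV"
  by (simp add: recip_levy_measure_def)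

lemma sigma_finite_\<nu>: "sigma_finite_measure \<nu>"
  unfolding recip_levy_measure_def
  by (subst sigma_finite_measure.sigma_finite_iff_density_finite[OF sigma_finite_lborel]) auto

lemma AE_\<nu>: "(AE v in \<nu>. P v) \<longleftrightarrow> (AE v in lborel. 0 < v \<longrightarrow> P v)"
  unfolding recip_levy_measure_def
  using c_pos by (subst AE_density) (auto intro!: AE_cong simp: ennreal_zero_less_mult_iff split: split_indicator)

lemma integral_\<nu>:
  fixes g :: "real \<Rightarrow> 'b::{banach, second_countable_topology}"
  assumes [measurable]: "g \<in> borel_measurable borel"
  shows "(LINT v|\<nu>. g v) = (LINT v|lborel. (indicator {0<..} v * (c * v powr \<beta>)) *\<^sub>R g v)"
  unfolding recip_levy_measure_def using c_pos
  by (subst integral_density) auto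

lemma integrable_\<nu>:
  fixes g :: "real \<Rightarrow> 'b::{banach, second_countable_topology}"
  assumes [measurable]: "g \<in> borel_measurable borel"
  shows "integrable \<nu> g \<longleftrightarrow> integrable lborel (\<lambda>v. (indicator {0<..} v * (c * v powr \<beta>)) *\<^sub>R g v)"
  unfolding recip_levy_measure_def using c_pos
  by (subst integrable_density) auto

lemma integrable_min: "integrable \<nu> (\<lambda>v. min (1 / v) (1 / v\<^sup>2))"
  using integrable_mult_right[OF integrable_power_min[OF \<beta>_pos \<beta>_less_1], of c]
  by (subst integrable_\<nu>) (simp_all add: mult_ac)

definition growth_const :: real where "growth_const = 2 * (LINT v|\<nu>. min (1 / v) (1 / v\<^sup>2))"

lemma growth_const_nonneg: "0 \<le> growth_const"
proof -
  have "0 \<le> (LINT v|\<nu>. min (1 / v) (1 / v\<^sup>2))"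
    by (rule integral_nonneg_AE) (simp add: AE_\<nu>)
  then show ?thesis by (simp add: growth_const_def)
qed

lemma integrable_compensated: "integrable \<nu> (\<lambda>v. compensated_iexp (s / v))"
proof (rule Bochner_Integration.integrable_bound)
  show "integrable \<nu> (\<lambda>v. 2 * (\<bar>s\<bar> + s\<^sup>2) * min (1 / v) (1 / v\<^sup>2))"
    by (intro integrable_mult_right integrable_min)
  show "AE v in \<nu>. norm (compensated_iexp (s / v)) \<le> norm (2 * (\<bar>s\<bar> + s\<^sup>2) * min (1 / v) (1 / v\<^sup>2))"
    unfolding AE_\<nu> real_norm_def
    by (intro AE_I2 impI order_trans[OF norm_compensated_iexp_divide_le abs_ge_self])
qed measurable

lemma integral_norm_compensated_le: "(LINT v|\<nu>. norm (compensated_iexp (s / v))) \<le> growth_const * (\<bar>s\<bar> + s\<^sup>2)"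
proof -
  have "(LINT v|\<nu>. norm (compensated_iexp (s / v))) \<le> (LINT v|\<nu>. 2 * (\<bar>s\<bar> + s\<^sup>2) * min (1 / v) (1 / v\<^sup>2))"
    unfolding AE_\<nu>
    by (intro integral_mono_AE integrable_norm integrable_compensated integrable_mult_right integrable_min
          AE_\<nu>[THEN iffD2] AE_I2 impI norm_compensated_iexp_divide_le)
  also have "\<dots> = 2 * (\<bar>s\<bar> + s\<^sup>2) * (LINT v|\<nu>. min (1 / v) (1 / v\<^sup>2))"
    by (rule integral_mult_right_zero)
  finally show ?thesis by (simp only: growth_const_def mult_ac)
qed

lemma norm_\<psi>_le: "norm (\<psi> s) \<le> growth_const * (\<bar>s\<bar> + s\<^sup>2)"
  unfolding stable_exponent_def
  by (rule order_trans[OF integral_norm_bound integral_norm_compensated_le])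

lemma \<psi>_0: "\<psi> 0 = 0"
  using norm_\<psi>_le[of 0] by simp

lemma isCont_\<psi>_0: "isCont \<psi> 0"
proof -
  have "((\<lambda>s. growth_const * (\<bar>s\<bar> + s\<^sup>2)) \<longlongrightarrow> growth_const * (\<bar>0\<bar> + 0\<^sup>2)) (at 0)"
    by (intro tendsto_intros)
  then have lim: "((\<lambda>s. growth_const * (\<bar>s\<bar> + s\<^sup>2)) \<longlongrightarrow> 0) (at 0)" by simp
  have "(\<psi> \<longlongrightarrow> 0) (at 0)"
    by (rule Lim_null_comparison[OF always_eventually[OF allI[OF norm_\<psi>_le]] lim])
  then show ?thesis by (simp add: isCont_def \<psi>_0)
qed

lemma integrable_cos: "integrable \<nu> (\<lambda>v. 1 - cos (s / v))"
  and Re_\<psi>: "Re (\<psi> s) = - (LINT v|\<nu>. 1 - cos (s / v))"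
proof -
  have eq: "1 - cos (s / v) = - Re (compensated_iexp (s / v))" for v
    by (simp add: compensated_iexp_def Re_exp)
  show "integrable \<nu> (\<lambda>v. 1 - cos (s / v))"
    unfolding eq using integrable_compensated by (intro integrable_minus integrable_Re)
  show "Re (\<psi> s) = - (LINT v|\<nu>. 1 - cos (s / v))"
    unfolding eq stable_exponent_def using integral_Re[OF integrable_compensated, of s] by simp
qed

lemma Re_\<psi>_le_0: "Re (\<psi> s) \<le> 0"
  unfolding Re_\<psi> by simp

text \<open>The integrand \<open>1 - cos (s / v)\<close> is nonnegative, so a vanishing integral
  would make it vanish almost everywhere. Strictness is what makes the characteristic function of
  the limit law decay.\<close>

lemma Re_\<psi>_less_0:
  assumes "s \<noteq> 0"
  shows "Re (\<psi> s) < 0"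
proof (rule ccontr)
  assume "\<not> Re (\<psi> s) < 0"
  then have "(LINT v|\<nu>. 1 - cos (s / v)) = 0"
    using Re_\<psi>_le_0[of s] Re_\<psi>[of s] by linarith
  then have "AE v in \<nu>. 1 - cos (s / v) = 0"
    by (subst (asm) integral_nonneg_eq_0_iff_AE[OF integrable_cos]) auto
  then have AE1: "AE v in lborel. 0 < v \<longrightarrow> cos (s / v) = 1"
    by (simp add: AE_\<nu>)
  \<comment> \<open>On this interval \<open>\<bar>s / v\<bar>\<close> lies strictly between 1 and 2,
    inside the range where the cosine decreases from 1.\<close>
  have "cos (s / v) \<noteq> 1" if "v \<in> {\<bar>s\<bar>/2<..<\<bar>s\<bar>}" for v
  proof -
    have v: "0 < v" "1 < \<bar>s / v\<bar>" "\<bar>s / v\<bar> < 2"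
      using that assms by (auto simp: abs_divide field_simps)
    have "cos \<bar>s / v\<bar> < cos 0"
      using v pi_gt3 by (intro cos_monotone_0_pi) auto
    then show ?thesis by (simp only: cos_abs_real cos_zero)
  qed
  then have "v \<notin> {\<bar>s\<bar>/2<..<\<bar>s\<bar>}" if "0 < v \<longrightarrow> cos (s / v) = 1" for v
    using that abs_ge_zero[of s] by (metis greaterThanLessThan_iff half_gt_zero_iff less_le_trans
      linorder_not_less order_less_trans zero_less_abs_iff assms)
  with AE1 have "AE v in lborel. v \<notin> {\<bar>s\<bar>/2<..<\<bar>s\<bar>}"
    by (rule eventually_mono)
  then have "emeasure lborel {\<bar>s\<bar>/2<..<\<bar>s\<bar>} = 0"
    by (subst (asm) AE_iff_measurable[where N="{\<bar>s\<bar>/2<..<\<bar>s\<bar>}"]) auto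
  then show False using assms by simp
qed

text \<open>Replacing \<open>v\<close> by \<open>x * v\<close> contributes
  \<open>x powr \<beta>\<close> from the density and \<open>x\<close> from Lebesgue measure. This
  homogeneity is the stability of the limit law; it drives both the tails and the decay of the
  characteristic function.\<close>

lemma \<psi>_scale:
  assumes x: "0 < x"
  shows "\<psi> (s / x) = x powr (- 1 - \<beta>) *\<^sub>R \<psi> s"
proof -
  have "\<psi> s = (LINT v|lborel. (indicator {0<..} v * (c * v powr \<beta>)) *\<^sub>R compensated_iexp (s / v))"
    unfolding stable_exponent_def by (rule integral_\<nu>) measurable
  also have "\<dots> = x *\<^sub>R (LINT v|lborel. (indicator {0<..} (x * v) * (c * (x * v) powr \<beta>)) *\<^sub>R compensated_iexp (s / (x * v)))"
    by (subst lborel_integral_real_affine[where c = x and t = 0]) (use x in auto)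
  also have "(\<lambda>v. (indicator {0<..} (x * v) * (c * (x * v) powr \<beta>)) *\<^sub>R compensated_iexp (s / (x * v))) =
      (\<lambda>v. x powr \<beta> *\<^sub>R ((indicator {0<..} v * (c * v powr \<beta>)) *\<^sub>R compensated_iexp (s / x / v)))"
    using x by (auto simp: fun_eq_iff powr_mult zero_less_mult_iff split: split_indicator)
  also have "(LINT v|lborel. x powr \<beta> *\<^sub>R ((indicator {0<..} v * (c * v powr \<beta>)) *\<^sub>R compensated_iexp (s / x / v))) =
      x powr \<beta> *\<^sub>R \<psi> (s / x)"
    unfolding stable_exponent_def by (subst integral_\<nu>) (simp_all only: integral_scaleR_right, measurable)
  finally have "\<psi> s = (x powr (1 + \<beta>)) *\<^sub>R \<psi> (s / x)"
    using x by (simp add: powr_add)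
  moreover have "x powr (- 1 - \<beta>) * x powr (1 + \<beta>) = 1"
    using x by (subst powr_add[symmetric]) simp
  ultimately show ?thesis by simp
qed

end

subsection \<open>Tails and atoms of the stable law\<close>

text \<open>The weighted measures are normalised to probability laws \<open>P n\<close>. Levy's
  theorem gives their weak convergence to \<open>Q\<close>, and then bounded functions that are
  continuous \<open>Q\<close>-almost everywhere may be integrated. The weight keeps the masses
  bounded when \<open>a n\<close> tends to infinity while \<open>W n\<close> concentrates at
  0.\<close>

lemma weighted_char_convergence:
  fixes W :: "nat \<Rightarrow> real measure" and a :: "nat \<Rightarrow> real" and w :: "real \<Rightarrow> real" and g :: "real \<Rightarrow> real"
  assumes rd: "\<And>n. real_distribution (W n)" and Q: "real_distribution Q"
    and a: "\<And>n. 0 \<le> a n"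
    and w [measurable]: "w \<in> borel_measurable borel" and w0: "\<And>y. 0 \<le> w y" and w1: "\<And>y. w y \<le> 1"
    and m: "0 < m"
    and lim: "\<And>s. (\<lambda>n. a n *\<^sub>R (CLINT y|W n. w y *\<^sub>R iexp (s * y))) \<longlonglongrightarrow> m *\<^sub>R char Q s"
    and g [measurable]: "g \<in> borel_measurable borel" and gB: "\<And>y. norm (g y) \<le> B"
    and disc: "emeasure Q {x. \<not> isCont g x} = 0"
  shows "(\<lambda>n. a n * (LINT y|W n. w y * g y)) \<longlonglongrightarrow> m * (LINT y|Q. g y)"
proof -
  interpret W: real_distribution "W n" for n by (rule rd)
  interpret Q: real_distribution Q by (rule Q)
  define m' where "m' n = a n * (LINT y|W n. w y)" for n
  have int_w: "integrable (W n) w" for n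
    by (rule W.integrable_const_bound[where B = 1]) (auto simp: w0 w1)
  \<comment> \<open>At \<open>s = 0\<close> the hypothesis is the convergence of the total
    masses.\<close>
  have "(\<lambda>n. a n *\<^sub>R (CLINT y|W n. w y *\<^sub>R iexp (0 * y))) \<longlonglongrightarrow> m *\<^sub>R char Q 0"
    by (rule lim)
  then have "(\<lambda>n. complex_of_real (m' n)) \<longlonglongrightarrow> complex_of_real m"
    by (simp add: Q.char_zero m'_def scaleR_conv_of_real)
  then have m'_lim: "m' \<longlonglongrightarrow> m" by (simp add: tendsto_of_real_iff)
  then have ev: "\<forall>\<^sub>F n in sequentially. 0 < m' n" using m by (rule order_tendstoD)
  \<comment> \<open>\<open>Q\<close> is a default for the finitely many \<open>n\<close> whose mass
    is not positive, so that every \<open>P n\<close> is a probability law.\<close>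
  define P where "P n = (if 0 < m' n then density (W n) (\<lambda>y. ennreal (a n / m' n * w y)) else Q)" for n
  have P_eq: "P n = density (W n) (\<lambda>y. ennreal (a n / m' n * w y))" if "0 < m' n" for n
    using that by (simp add: P_def)
  have rdP: "real_distribution (P n)" for n
  proof (cases "0 < m' n")
    case True
    have "emeasure (P n) (space (P n)) = (\<integral>\<^sup>+y. ennreal (a n / m' n * w y) \<partial>W n)"
      using True by (simp add: P_eq emeasure_density)
    also have "\<dots> = ennreal (LINT y|W n. a n / m' n * w y)"
      using a[of n] w0 True int_w by (intro nn_integral_eq_integral integrable_mult_right) auto
    also have "\<dots> = 1" using True by (auto simp: m'_def)
    finally have "prob_space (P n)" by (rule prob_spaceI)
    then show ?thesis
      using True by (simp add: real_distribution_def real_distribution_axioms_def P_eq)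
  qed (simp add: P_def Q)
  have P_int: "(LINT y|P n. h y) = (a n / m' n) *\<^sub>R (LINT y|W n. w y *\<^sub>R h y)"
    if "0 < m' n" and [measurable]: "h \<in> borel_measurable borel"
    for n and h :: "real \<Rightarrow> 'b::{banach, second_countable_topology}"
  proof -
    have "(LINT y|P n. h y) = (LINT y|W n. (a n / m' n * w y) *\<^sub>R h y)"
      using that a[of n] w0 unfolding P_eq[OF that(1)] by (subst integral_density) auto
    then show ?thesis by (simp only: scaleR_scaleR[symmetric] integral_scaleR_right)
  qed
  have "weak_conv_m P Q"
  proof (rule levy_continuity[OF rdP Q])
    fix s
    have "(\<lambda>n. (1 / m' n) *\<^sub>R (a n *\<^sub>R (CLINT y|W n. w y *\<^sub>R iexp (s * y)))) \<longlonglongrightarrow> (1 / m) *\<^sub>R (m *\<^sub>R char Q s)"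
      using m by (intro tendsto_intros m'_lim lim) auto
    then have *: "(\<lambda>n. (1 / m' n) *\<^sub>R (a n *\<^sub>R (CLINT y|W n. w y *\<^sub>R iexp (s * y)))) \<longlonglongrightarrow> char Q s"
      using m by simp
    show "(\<lambda>n. char (P n) s) \<longlonglongrightarrow> char Q s"
      by (rule Lim_transform_eventually[OF *], rule eventually_mono[OF ev])
         (simp add: char_def P_int)
  qed
  then have "(\<lambda>n. LINT y|P n. g y) \<longlonglongrightarrow> (LINT y|Q. g y)"
    using rdP Q disc gB by (intro weak_conv_imp_bdd_ae_continuous_conv[where B = B]) auto
  then have *: "(\<lambda>n. m' n * (LINT y|P n. g y)) \<longlonglongrightarrow> m * (LINT y|Q. g y)"
    by (intro tendsto_mult m'_lim)
  show ?thesis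
    by (rule Lim_transform_eventually[OF *], rule eventually_mono[OF ev]) (simp add: P_int)
qed

text \<open>A difference quotient at 0 of the map sending \<open>t\<close> to
  \<open>exp (t * z)\<close>.\<close>

lemma exp_scaled_increment_tendsto:
  fixes z :: complex and \<tau> :: "nat \<Rightarrow> real"
  assumes "\<tau> \<longlonglongrightarrow> 0" "\<And>n. 0 < \<tau> n"
  shows "(\<lambda>n. (1 / \<tau> n) *\<^sub>R (exp (\<tau> n *\<^sub>R z) - 1)) \<longlonglongrightarrow> z"
proof -
  have "((\<lambda>t. exp (t * z)) has_field_derivative z) (at 0)"
    by (auto intro!: derivative_eq_intros)
  then have "((\<lambda>t. (exp (t * z) - 1) / t) \<longlongrightarrow> z) (at 0)"
    by (simp add: DERIV_def)
  moreover have "filterlim (\<lambda>n. complex_of_real (\<tau> n)) (at 0) sequentially"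
    using assms by (auto intro!: filterlim_atI tendsto_eq_intros eventually_sequentiallyI simp: less_imp_neq[THEN not_sym])
  ultimately have "(\<lambda>n. (exp (complex_of_real (\<tau> n) * z) - 1) / complex_of_real (\<tau> n)) \<longlonglongrightarrow> z"
    by (rule filterlim_compose)
  then show ?thesis by (simp add: scaleR_conv_of_real divide_inverse mult.commute)
qed

abbreviation gauss_weight :: "real \<Rightarrow> real" where
  "gauss_weight y \<equiv> 1 - exp (- y\<^sup>2 / 2)"

text \<open>At \<open>y = 1 / v\<close> the bound is the function of \<open>integrable_min\<close>,
  so the weighted Levy measure is finite.\<close>

lemma gauss_weight_le: "gauss_weight y \<le> min \<bar>y\<bar> (y\<^sup>2)"
proof -
  have a: "gauss_weight y \<le> y\<^sup>2 / 2" using exp_ge_add_one_self[of "- y\<^sup>2 / 2"] by simp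
  have b: "gauss_weight y \<le> 1" by simp
  show ?thesis
  proof (cases "\<bar>y\<bar> \<le> 1")
    case True
    then have "\<bar>y\<bar> * \<bar>y\<bar> \<le> \<bar>y\<bar> * 1" by (intro mult_left_mono) auto
    then have "y\<^sup>2 \<le> \<bar>y\<bar>" by (simp add: power2_eq_square)
    moreover have "gauss_weight y \<le> y\<^sup>2" using a zero_le_power2[of y] by linarith
    ultimately show ?thesis by (simp add: min_def)
  next
    case False
    then have "1 * 1 \<le> \<bar>y\<bar> * \<bar>y\<bar>" by (intro mult_mono) auto
    then have "1 \<le> y\<^sup>2" by (simp add: power2_eq_square)
    with False b show ?thesis by (intro min.boundedI; linarith)
  qed
qed

section \<open>Gaussian averages of increments of the stable exponent\<close>

context stable_parameters
begin

lemma measurable_\<psi> [measurable]: "\<psi> \<in> borel_measurable borel"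
proof -
  interpret sigma_finite_measure \<nu> by (rule sigma_finite_\<nu>)
  show ?thesis unfolding stable_exponent_def by measurable
qed

text \<open>Dominates \<open>norm (\<psi> s) + norm (\<psi> (s + h))\<close> by a polynomial in
  \<open>h\<close>, integrable under the normal law. The coefficients come from
  \<open>\<bar>x\<bar> \<le> 1 + x\<^sup>2\<close> at \<open>s\<close> and \<open>s + h\<close>, and
  from \<open>(s + h)\<^sup>2 \<le> 2 * s\<^sup>2 + 2 * h\<^sup>2\<close>.\<close>

definition incr_bound :: "real \<Rightarrow> real \<Rightarrow> real" where
  "incr_bound s h = growth_const * (2 + 6 * s\<^sup>2 + 4 * h\<^sup>2)"

lemma sum_le_incr_bound: "growth_const * (\<bar>s\<bar> + s\<^sup>2) + growth_const * (\<bar>s + h\<bar> + (s + h)\<^sup>2) \<le> incr_bound s h"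
proof -
  have a: "\<bar>x\<bar> \<le> 1 + x\<^sup>2" for x :: real
    by (metis abs_le_square_iff abs_ge_zero abs_square_le_1 add_increasing add_increasing2 linear one_power2 power2_abs power2_le_imp_le zero_le_one zero_le_power2 abs_1 order_trans self_le_power zero_less_numeral)
  have "(s + h)\<^sup>2 \<le> 2 * s\<^sup>2 + 2 * h\<^sup>2"
    using zero_le_power2[of "s - h"] by (simp add: power2_eq_square algebra_simps)
  with a[of s] a[of "s + h"]
  have "(\<bar>s\<bar> + s\<^sup>2) + (\<bar>s + h\<bar> + (s + h)\<^sup>2) \<le> 2 + 6 * s\<^sup>2 + 4 * h\<^sup>2" by linarith
  from mult_left_mono[OF this growth_const_nonneg] show ?thesis
    by (simp add: incr_bound_def distrib_left)
qed

lemma integrable_incr_bound: "integrable std_normal_distribution (incr_bound s)"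
proof -
  interpret N: prob_space std_normal_distribution by (rule prob_space_std_normal)
  show ?thesis
    unfolding incr_bound_def
    by (intro integrable_mult_right Bochner_Integration.integrable_add
        integrable_std_normal_distribution_moment) auto
qed

text \<open>The counterpart of \<open>char_gaussian_increment\<close> for the Levy measure: the
  compensation leaves a term odd in \<open>h\<close>, which averages to 0, and the rest produces the
  same Gaussian weight.\<close>

lemma \<psi>_gaussian_increment:
  "(CLINT h|std_normal_distribution. \<psi> s - \<psi> (s + h)) =
   (CLINT v|\<nu>. gauss_weight (1 / v) *\<^sub>R iexp (s / v))"
proof -
  interpret N: prob_space std_normal_distribution by (rule prob_space_std_normal)
  interpret \<nu>: sigma_finite_measure \<nu> by (rule sigma_finite_\<nu>)
  interpret P: pair_sigma_finite std_normal_distribution \<nu> ..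
  let ?f = "\<lambda>h v. compensated_iexp (s / v) - compensated_iexp ((s + h) / v)"
  have intf: "integrable \<nu> (?f h)" for h
    by (intro Bochner_Integration.integrable_diff integrable_compensated)
  \<comment> \<open>\<open>\<nu>\<close> has infinite mass, so a bounded integrand is not enough;
    the inner integral of the norm is bounded by \<open>incr_bound s\<close>.\<close>
  have int: "integrable (std_normal_distribution \<Otimes>\<^sub>M \<nu>) (\<lambda>(h, v). ?f h v)"
  proof (rule P.Fubini_integrable)
    show "(\<lambda>(h, v). ?f h v) \<in> borel_measurable (std_normal_distribution \<Otimes>\<^sub>M \<nu>)"
      by measurable
    show "integrable std_normal_distribution (\<lambda>h. LINT v|\<nu>. norm (case (h, v) of (h, v) \<Rightarrow> ?f h v))"
    proof (rule Bochner_Integration.integrable_bound[OF integrable_incr_bound[of s]])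
      show "AE h in std_normal_distribution. norm (LINT v|\<nu>. norm (case (h, v) of (h, v) \<Rightarrow> ?f h v)) \<le> norm (incr_bound s h)"
      proof (rule AE_I2)
        fix h
        have "(LINT v|\<nu>. norm (?f h v)) \<le>
            (LINT v|\<nu>. norm (compensated_iexp (s / v)) + norm (compensated_iexp ((s + h) / v)))"
          by (intro integral_mono norm_triangle_ineq4 Bochner_Integration.integrable_add
                integrable_norm intf integrable_compensated)
        also have "\<dots> = (LINT v|\<nu>. norm (compensated_iexp (s / v))) + (LINT v|\<nu>. norm (compensated_iexp ((s + h) / v)))"
          by (intro Bochner_Integration.integral_add integrable_norm integrable_compensated)
        also have "\<dots> \<le> growth_const * (\<bar>s\<bar> + s\<^sup>2) + growth_const * (\<bar>s + h\<bar> + (s + h)\<^sup>2)"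
          by (intro add_mono integral_norm_compensated_le)
        also have "\<dots> \<le> incr_bound s h" by (rule sum_le_incr_bound)
        finally show "norm (LINT v|\<nu>. norm (case (h, v) of (h, v) \<Rightarrow> ?f h v)) \<le> norm (incr_bound s h)"
          by simp
      qed
    qed measurable
    show "AE h in std_normal_distribution. integrable \<nu> (\<lambda>v. case (h, v) of (h, v) \<Rightarrow> ?f h v)"
      using intf by simp
  qed
  have "(CLINT h|std_normal_distribution. \<psi> s - \<psi> (s + h)) =
      (CLINT h|std_normal_distribution. CLINT v|\<nu>. ?f h v)"
    unfolding stable_exponent_def
    by (intro Bochner_Integration.integral_cong refl Bochner_Integration.integral_diff[symmetric]
          integrable_compensated)
  also have "\<dots> = (CLINT v|\<nu>. CLINT h|std_normal_distribution. ?f h v)"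
    by (rule P.Fubini_integral[symmetric]) (rule int)
  also have "\<dots> = (CLINT v|\<nu>. gauss_weight (1 / v) *\<^sub>R iexp (s / v))"
  proof (intro Bochner_Integration.integral_cong refl)
    fix v :: real
    have i1: "integrable std_normal_distribution (\<lambda>h. 1 - iexp (1 / v * h))"
      by (intro Bochner_Integration.integrable_diff N.integrable_iexp) auto
    have i2: "integrable std_normal_distribution (\<lambda>h. \<i> * complex_of_real (h / v))"
      using integrable_std_normal_distribution_moment[of 1]
      by (intro integrable_mult_right integrable_of_real integrable_divide) auto
    have "(CLINT h|std_normal_distribution. ?f h v) =
        (CLINT h|std_normal_distribution. iexp (s / v) * (1 - iexp (1 / v * h)) + \<i> * complex_of_real (h / v))"
      by (simp add: compensated_iexp_def algebra_simps add_divide_distrib exp_add)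
    also have "\<dots> = (CLINT h|std_normal_distribution. iexp (s / v) * (1 - iexp (1 / v * h)))
        + (CLINT h|std_normal_distribution. \<i> * complex_of_real (h / v))"
      by (intro Bochner_Integration.integral_add integrable_mult_right i1 i2)
    also have "(CLINT h|std_normal_distribution. \<i> * complex_of_real (h / v)) = 0"
      using integral_std_normal_distribution_moment_odd[of 1] by simp
    also have "(CLINT h|std_normal_distribution. iexp (s / v) * (1 - iexp (1 / v * h))) =
        iexp (s / v) * (CLINT h|std_normal_distribution. 1 - iexp (1 / v * h))"
      by (rule integral_mult_right_zero)
    also note integral_one_minus_iexp_gaussian
    finally show "(CLINT h|std_normal_distribution. ?f h v) = gauss_weight (1 / v) *\<^sub>R iexp (s / v)"
      by (simp add: scaleR_conv_of_real mult.commute)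
  qed
  finally show ?thesis .
qed

lemma integrable_gauss_weight: "integrable \<nu> (\<lambda>v. gauss_weight (1 / v))"
proof (rule Bochner_Integration.integrable_bound[OF integrable_min])
  show "AE v in \<nu>. norm (gauss_weight (1 / v)) \<le> norm (min (1 / v) (1 / v\<^sup>2))"
    unfolding AE_\<nu>
  proof (intro AE_I2 impI)
    fix v :: real assume "0 < v"
    then show "norm (gauss_weight (1 / v)) \<le> norm (min (1 / v) (1 / v\<^sup>2))"
      using gauss_weight_le[of "1 / v"] by (simp add: power_divide)
  qed
qed measurable

text \<open>Pointwise in \<open>h\<close> this is \<open>exp_scaled_increment_tendsto\<close>. As
  \<psi> has nonpositive real part, \<open>norm_exp_minus_one_le\<close> bounds the quotients
  uniformly in \<open>n\<close>, and \<open>incr_bound s\<close> dominates.\<close>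

lemma increment_tendsto:
  fixes \<tau> :: "nat \<Rightarrow> real"
  assumes \<tau>: "\<tau> \<longlonglongrightarrow> 0" "\<And>n. 0 < \<tau> n"
  shows "(\<lambda>n. (1 / \<tau> n) *\<^sub>R (CLINT h|std_normal_distribution.
      exp (\<tau> n *\<^sub>R \<psi> s) - exp (\<tau> n *\<^sub>R \<psi> (s + h))))
    \<longlonglongrightarrow> (CLINT h|std_normal_distribution. \<psi> s - \<psi> (s + h))"
proof -
  let ?d = "\<lambda>n z. (1 / \<tau> n) *\<^sub>R (exp (\<tau> n *\<^sub>R z) - 1 :: complex)"
  have eq: "(1 / \<tau> n) *\<^sub>R (exp (\<tau> n *\<^sub>R y) - exp (\<tau> n *\<^sub>R z)) = ?d n y - ?d n z" for n y z
    by (simp add: scaleR_diff_right)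
  have le: "norm (?d n z) \<le> norm z" if "Re z \<le> 0" for n z
  proof -
    have "norm (exp (\<tau> n *\<^sub>R z) - 1) \<le> norm (\<tau> n *\<^sub>R z)"
      using that \<tau>(2)[of n] by (intro norm_exp_minus_one_le) (simp add: mult_nonneg_nonpos)
    also have "norm (\<tau> n *\<^sub>R z) = \<tau> n * norm z" using \<tau>(2)[of n] by simp
    finally show ?thesis using \<tau>(2)[of n] by (simp add: pos_divide_le_eq mult.commute del: scaleR_diff_right)
  qed
  have "(\<lambda>n. CLINT h|std_normal_distribution. ?d n (\<psi> s) - ?d n (\<psi> (s + h)))
    \<longlonglongrightarrow> (CLINT h|std_normal_distribution. \<psi> s - \<psi> (s + h))"
  proof (rule integral_dominated_convergence[where w = "incr_bound s"])
    show "AE h in std_normal_distribution. norm (?d n (\<psi> s) - ?d n (\<psi> (s + h))) \<le> incr_bound s h" for n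
    proof (rule AE_I2)
      fix h
      have "norm (?d n (\<psi> s) - ?d n (\<psi> (s + h))) \<le> norm (\<psi> s) + norm (\<psi> (s + h))"
        by (intro order_trans[OF norm_triangle_ineq4] add_mono le Re_\<psi>_le_0)
      also have "\<dots> \<le> incr_bound s h"
        by (intro order_trans[OF _ sum_le_incr_bound] add_mono norm_\<psi>_le)
      finally show "norm (?d n (\<psi> s) - ?d n (\<psi> (s + h))) \<le> incr_bound s h" .
    qed
  qed (auto intro!: AE_I2 tendsto_diff exp_scaled_increment_tendsto \<tau> integrable_incr_bound)
  then show ?thesis unfolding eq[symmetric] by simp
qed

end

section \<open>The weighted Levy measure and the tails of the limit law\<close>

context stable_parameters
begin

text \<open>Strict positivity is asked on the unit interval because the integrand behind the tail
  constant, \<open>indicator {1<..} (1 / v)\<close>, is positive exactly there.\<close>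

lemma integral_\<nu>_pos:
  fixes g :: "real \<Rightarrow> real"
  assumes int: "integrable \<nu> g"
    and nonneg: "\<And>v. 0 < v \<Longrightarrow> 0 \<le> g v" and pos: "\<And>v. 0 < v \<Longrightarrow> v < 1 \<Longrightarrow> 0 < g v"
  shows "0 < (LINT v|\<nu>. g v)"
proof (rule ccontr)
  have nn: "AE v in \<nu>. 0 \<le> g v" by (simp add: AE_\<nu> nonneg)
  assume "\<not> 0 < (LINT v|\<nu>. g v)"
  with integral_nonneg_AE[OF nn] have "(LINT v|\<nu>. g v) = 0" by linarith
  then have "AE v in \<nu>. g v = 0"
    by (subst (asm) integral_nonneg_eq_0_iff_AE[OF int nn])
  then have "AE v in lborel. 0 < v \<longrightarrow> g v = 0" by (simp add: AE_\<nu>)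
  then have "AE v in lborel. v \<notin> {0<..<1::real}"
    by (rule eventually_mono) (use pos in fastforce)
  then have "emeasure lborel {0<..<1::real} = 0"
    by (subst (asm) AE_iff_measurable[where N="{0<..<1}"]) auto
  then show False by simp
qed

definition weight_mass :: real where "weight_mass = (LINT v|\<nu>. gauss_weight (1 / v))"

lemma weight_mass_pos: "0 < weight_mass"
  unfolding weight_mass_def by (rule integral_\<nu>_pos[OF integrable_gauss_weight]) auto

text \<open>Back in the coordinate \<open>y = 1 / v\<close>. The weight tames the infinite mass near
  \<open>y = 0\<close>, so that the result can serve as the limit \<open>Q\<close> of
  \<open>weighted_char_convergence\<close>.\<close>

definition tilted_levy :: "real measure" where
  "tilted_levy = distr (density \<nu> (\<lambda>v. ennreal (gauss_weight (1 / v) / weight_mass))) borel (\<lambda>v. 1 / v)"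

lemma real_distribution_tilted_levy: "real_distribution tilted_levy"
proof -
  let ?D = "density \<nu> (\<lambda>v. ennreal (gauss_weight (1 / v) / weight_mass))"
  have "emeasure ?D (space ?D) = (\<integral>\<^sup>+v. ennreal (gauss_weight (1 / v) / weight_mass) \<partial>\<nu>)"
    by (simp add: emeasure_density)
  also have "\<dots> = ennreal (LINT v|\<nu>. gauss_weight (1 / v) / weight_mass)"
    using weight_mass_pos
    by (intro nn_integral_eq_integral integrable_divide integrable_gauss_weight AE_I2) auto
  also have "\<dots> = 1"
    using weight_mass_pos by (simp add: weight_mass_def)
  finally interpret D: prob_space ?D by (rule prob_spaceI)
  show ?thesis unfolding tilted_levy_def by (rule D.real_distribution_distr) simp
qed

lemma integral_tilted_levy:
  fixes g :: "real \<Rightarrow> 'b::{banach, second_countable_topology}"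
  assumes [measurable]: "g \<in> borel_measurable borel"
  shows "weight_mass *\<^sub>R (LINT y|tilted_levy. g y) = (LINT v|\<nu>. gauss_weight (1 / v) *\<^sub>R g (1 / v))"
proof -
  have "(LINT y|tilted_levy. g y) = (LINT v|\<nu>. (gauss_weight (1 / v) / weight_mass) *\<^sub>R g (1 / v))"
    unfolding tilted_levy_def using weight_mass_pos
    by (simp add: integral_distr integral_density)
  also have "\<dots> = (LINT v|\<nu>. (1 / weight_mass) *\<^sub>R (gauss_weight (1 / v) *\<^sub>R g (1 / v)))"
    by simp
  also have "\<dots> = (1 / weight_mass) *\<^sub>R (LINT v|\<nu>. gauss_weight (1 / v) *\<^sub>R g (1 / v))"
    by (rule integral_scaleR_right)
  finally show ?thesis using weight_mass_pos by simp
qed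

text \<open>Inherited from Lebesgue measure. Half-lines, whose frontier is a point, thereby qualify
  for \<open>scaled_tail_tendsto\<close>.\<close>

lemma tilted_levy_singleton: "emeasure tilted_levy {y} = 0"
proof -
  have "AE v in \<nu>. 1 / v \<noteq> y"
    unfolding AE_\<nu>
  proof (rule eventually_mono)
    show "AE v in lborel. v \<noteq> 1 / y" by (rule AE_lborel_singleton)
  qed auto
  then have "AE v in density \<nu> (\<lambda>v. ennreal (gauss_weight (1 / v) / weight_mass)). 1 / v \<noteq> y"
    by (subst AE_density) (auto elim: eventually_mono)
  then have "AE z in tilted_levy. z \<noteq> y"
    unfolding tilted_levy_def by (subst AE_distr_iff) auto
  then show ?thesis
    by (subst (asm) AE_iff_measurable[where N="{y}"]) (auto simp: tilted_levy_def)
qed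

text \<open>Undoes the weight on a set away from 0, where the weight is at least 1/4 and equals the
  maximum. The maximum keeps the function bounded by 4 and continuous off the frontier of
  \<open>A\<close>.\<close>

definition trunc_inverse_weight :: "real set \<Rightarrow> real \<Rightarrow> real" where
  "trunc_inverse_weight A y = indicator A y * (1 / max (gauss_weight y) (1 / 4))"

lemma weight_times_inverse:
  assumes "\<And>y. y \<in> A \<Longrightarrow> 1 \<le> \<bar>y\<bar>"
  shows "gauss_weight y * trunc_inverse_weight A y = indicator A y"
proof (cases "y \<in> A")
  case True
  with one_minus_exp_half_ge[of y] assms have "1 / 4 \<le> gauss_weight y" by simp
  moreover from this have "gauss_weight y \<noteq> 0" by linarith
  ultimately show ?thesis using True by (simp add: trunc_inverse_weight_def max_def)
qed (simp add: trunc_inverse_weight_def)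

text \<open>
  The characteristic function of \<open>G\<close> rescaled by \<open>x\<close> is \<open>exp (x powr (- 1 - \<beta>) * \<psi> s)\<close>: the tail of \<open>G\<close> at
  \<open>x\<close> is the small-time behaviour of the Levy process, hence governed by the Levy measure.
\<close>

lemma scaled_tail_tendsto:
  fixes x :: "nat \<Rightarrow> real"
  assumes G: "real_distribution G" and chG: "\<And>s. char G s = exp (\<psi> s)"
    and x: "filterlim x at_top sequentially" "\<And>n. 0 < x n"
    and A [measurable]: "A \<in> sets borel" and A1: "\<And>y. y \<in> A \<Longrightarrow> 1 \<le> \<bar>y\<bar>"
    and fr: "emeasure tilted_levy (frontier A) = 0"
  shows "(\<lambda>n. x n powr (1 + \<beta>) * measure G {z. z / x n \<in> A}) \<longlonglongrightarrow>
    (LINT v|\<nu>. indicator A (1 / v))"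
proof -
  interpret G: real_distribution G by (rule G)
  interpret Q: real_distribution tilted_levy by (rule real_distribution_tilted_levy)
  define \<tau> where "\<tau> n = x n powr (- 1 - \<beta>)" for n
  define W where "W n = distr G borel (\<lambda>z. z / x n)" for n
  have \<tau>_pos: "0 < \<tau> n" for n using x(2)[of n] by (simp add: \<tau>_def)
  have \<tau>_inv: "1 / \<tau> n = x n powr (1 + \<beta>)" for n
    using powr_minus[of "x n" "1 + \<beta>"] by (simp add: \<tau>_def divide_inverse algebra_simps)
  have \<tau>_lim: "\<tau> \<longlonglongrightarrow> 0"
    unfolding \<tau>_def using \<beta>_pos by (intro tendsto_neg_powr x) auto
  have rdW: "real_distribution (W n)" for n
    unfolding W_def by (rule G.real_distribution_distr) simp
  have chW: "char (W n) s = exp (\<tau> n *\<^sub>R \<psi> s)" for n s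
  proof -
    have "char (W n) s = char G (s / x n)"
      by (simp add: char_def W_def integral_distr)
    also have "\<dots> = exp (\<psi> (s / x n))" by (rule chG)
    finally show ?thesis by (simp add: \<psi>_scale[OF x(2)] \<tau>_def)
  qed
  let ?g = "trunc_inverse_weight A"
  have g [measurable]: "?g \<in> borel_measurable borel"
    unfolding trunc_inverse_weight_def by measurable
  have gB: "norm (?g y) \<le> 4" for y
  proof -
    have "1 / max (gauss_weight y) (1 / 4) \<le> 1 / (1/4)" by (intro divide_left_mono) auto
    then show ?thesis by (auto simp: trunc_inverse_weight_def split: split_indicator)
  qed
  have disc: "{y. \<not> isCont ?g y} \<subseteq> frontier A"
  proof safe
    fix y assume "\<not> isCont ?g y"
    moreover have "isCont ?g y" if "y \<notin> frontier A"
    proof -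
      have "isCont (\<lambda>y. max (gauss_weight y) (1 / 4)) y" by (intro continuous_intros) auto
      moreover have "isCont (indicator A :: real \<Rightarrow> real) y" using that by (simp add: isCont_indicator)
      ultimately show ?thesis
        unfolding trunc_inverse_weight_def by (intro isCont_mult isCont_divide continuous_const) auto
    qed
    ultimately show "y \<in> frontier A" by blast
  qed
  have "(\<lambda>n. 1 / \<tau> n * (LINT y|W n. gauss_weight y * ?g y)) \<longlonglongrightarrow> weight_mass * (LINT y|tilted_levy. ?g y)"
  proof (rule weighted_char_convergence[OF rdW real_distribution_tilted_levy])
    show "(\<lambda>n. (1 / \<tau> n) *\<^sub>R (CLINT y|W n. gauss_weight y *\<^sub>R iexp (s * y)))
        \<longlonglongrightarrow> weight_mass *\<^sub>R char tilted_levy s" for s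
    proof -
      have "weight_mass *\<^sub>R char tilted_levy s = (CLINT v|\<nu>. gauss_weight (1 / v) *\<^sub>R iexp (s / v))"
        unfolding char_def by (subst integral_tilted_levy) auto
      also have "\<dots> = (CLINT h|std_normal_distribution. \<psi> s - \<psi> (s + h))"
        by (rule \<psi>_gaussian_increment[symmetric])
      finally have eq: "weight_mass *\<^sub>R char tilted_levy s = (CLINT h|std_normal_distribution. \<psi> s - \<psi> (s + h))" .
      \<comment> \<open>The case \<open>u = 1\<close> of \<open>char_gaussian_increment\<close>.
        Together with \<open>eq\<close> it reduces the claim to the convergence of increments of
        small-time exponentials.\<close>
      have eq2: "(CLINT y|W n. gauss_weight y *\<^sub>R iexp (s * y)) =
          (CLINT h|std_normal_distribution. exp (\<tau> n *\<^sub>R \<psi> s) - exp (\<tau> n *\<^sub>R \<psi> (s + h)))" for n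
        using real_distribution.char_gaussian_increment[OF rdW, of n s 1] by (simp only: chW mult_1)
      show ?thesis unfolding eq eq2 by (rule increment_tendsto[OF \<tau>_lim \<tau>_pos])
    qed
    show "emeasure tilted_levy {y. \<not> isCont ?g y} = 0"
      using fr disc by (metis Q.events_eq_borel closed_Compl borel_closed emeasure_mono frontier_closed le_zero_eq)
  qed (use \<tau>_pos weight_mass_pos g gB in \<open>auto intro: less_imp_le\<close>)
  \<comment> \<open>The test function cancels the weight on \<open>A\<close>, here in the limit and
    below in the sequence.\<close>
  also have "weight_mass * (LINT y|tilted_levy. ?g y) = (LINT v|\<nu>. indicator A (1 / v))"
    using integral_tilted_levy[OF g] by (simp only: real_scaleR_def weight_times_inverse[OF A1])
  also have "(\<lambda>n. 1 / \<tau> n * (LINT y|W n. gauss_weight y * ?g y)) =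
      (\<lambda>n. x n powr (1 + \<beta>) * measure G {z. z / x n \<in> A})"
  proof
    fix n
    interpret W: real_distribution "W n" by (rule rdW)
    have "(LINT y|W n. gauss_weight y * ?g y) = measure (W n) A"
      by (simp only: weight_times_inverse[OF A1]) simp
    also have "\<dots> = measure G {z. z / x n \<in> A}"
      by (simp add: W_def measure_distr vimage_def)
    finally show "1 / \<tau> n * (LINT y|W n. gauss_weight y * ?g y) =
      x n powr (1 + \<beta>) * measure G {z. z / x n \<in> A}" by (simp only: \<tau>_inv)
  qed
  finally show ?thesis .
qed

text \<open>A sequence tending to infinity eventually equals its maximum with 1, which is positive
  throughout.\<close>

lemma tendsto_at_top_of_positive_sequences:
  fixes f :: "real \<Rightarrow> real"
  assumes "\<And>x. filterlim x at_top sequentially \<Longrightarrow> (\<And>n. 0 < x n) \<Longrightarrow> (\<lambda>n. f (x n)) \<longlonglongrightarrow> l"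
  shows "(f \<longlongrightarrow> l) at_top"
proof (rule tendsto_at_topI_sequentially)
  fix x :: "nat \<Rightarrow> real" assume x: "filterlim x at_top sequentially"
  have ev: "\<forall>\<^sub>F n in sequentially. max 1 (x n) = x n"
    using x[unfolded filterlim_at_top, rule_format, of 1] by (rule eventually_mono) auto
  have "filterlim (\<lambda>n. max 1 (x n)) at_top sequentially"
    by (rule filterlim_at_top_mono[OF x]) (auto intro: always_eventually)
  then have "(\<lambda>n. f (max 1 (x n))) \<longlonglongrightarrow> l" by (rule assms) (simp add: less_max_iff_disj)
  then show "(\<lambda>n. f (x n)) \<longlonglongrightarrow> l"
    by (rule Lim_transform_eventually) (rule eventually_mono[OF ev], simp)
qed

text \<open>The sets \<open>{1<..}\<close> and \<open>{..-1}\<close> in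
  \<open>scaled_tail_tendsto\<close> give the two tails. The left constant is 0 because
  \<open>1 / v\<close> is positive for \<open>\<nu>\<close>-almost every \<open>v\<close>: this is
  the imbalance of the law.\<close>

lemma stable_tails:
  assumes G: "real_distribution G" and chG: "\<And>s. char G s = exp (\<psi> s)"
  shows "\<exists>C>0. ((\<lambda>x. x powr (1 + \<beta>) * (1 - cdf G x)) \<longlongrightarrow> C) at_top \<and>
    ((\<lambda>x. x powr (1 + \<beta>) * cdf G (- x)) \<longlongrightarrow> 0) at_top"
proof -
  interpret G: real_distribution G by (rule G)
  define C :: real where "C = (LINT v|\<nu>. indicator {1<..} (1 / v))"
  have "integrable \<nu> (\<lambda>v. indicator {1<..} (1 / v) :: real)"
  proof (rule Bochner_Integration.integrable_bound[OF integrable_mult_right[OF integrable_gauss_weight, of 4]])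
    show "AE v in \<nu>. norm (indicator {1<..} (1 / v) :: real) \<le> norm (4 * gauss_weight (1 / v))"
    proof (rule AE_I2)
      fix v :: real
      show "norm (indicator {1<..} (1 / v) :: real) \<le> norm (4 * gauss_weight (1 / v))"
      proof (cases "1 < 1 / v")
        case True
        then have ge: "1 \<le> \<bar>1 / v\<bar>" by linarith
        have "1 \<le> norm (4 * t)" if "1 / 4 \<le> t" for t :: real using that by simp
        from this[OF one_minus_exp_half_ge[OF ge]] have "1 \<le> norm (4 * gauss_weight (1 / v))" .
        moreover have "norm (indicator {1<..} (1 / v) :: real) = 1" using True by simp
        ultimately show ?thesis by (simp only:)
      qed simp
    qed
  qed measurable
  then have C: "0 < C"
    unfolding C_def by (rule integral_\<nu>_pos) auto
  have "((\<lambda>x. x powr (1 + \<beta>) * (1 - cdf G x)) \<longlongrightarrow> C) at_top"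
  proof (rule tendsto_at_top_of_positive_sequences)
    fix x :: "nat \<Rightarrow> real" assume x: "filterlim x at_top sequentially" "\<And>n. 0 < x n"
    have "measure G {z. z / x n \<in> {1<..}} = 1 - cdf G (x n)" for n
    proof -
      have "{z. z / x n \<in> {1<..}} = space G - {..x n}" using x(2)[of n] by (auto simp: field_simps)
      then show ?thesis by (simp add: G.prob_compl cdf_def del: G.space_eq_univ)
    qed
    then show "(\<lambda>n. x n powr (1 + \<beta>) * (1 - cdf G (x n))) \<longlonglongrightarrow> C"
      using scaled_tail_tendsto[OF G chG x, of "{1<..}"]
      by (simp add: C_def frontier_real_greaterThan tilted_levy_singleton)
  qed
  moreover have "((\<lambda>x. x powr (1 + \<beta>) * cdf G (- x)) \<longlongrightarrow> 0) at_top"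
  proof (rule tendsto_at_top_of_positive_sequences)
    fix x :: "nat \<Rightarrow> real" assume x: "filterlim x at_top sequentially" "\<And>n. 0 < x n"
    have "measure G {z. z / x n \<in> {..-1}} = cdf G (- x n)" for n
    proof -
      have "{z. z / x n \<in> {..-1}} = {..- x n}" using x(2)[of n] by (auto simp: field_simps)
      then show ?thesis by (simp add: cdf_def)
    qed
    moreover have "(LINT v|\<nu>. indicator {..-1} (1 / v)) = (0 :: real)"
      by (rule integral_eq_zero_AE) (auto simp: AE_\<nu> divide_simps split: split_indicator)
    ultimately show "(\<lambda>n. x n powr (1 + \<beta>) * cdf G (- x n)) \<longlonglongrightarrow> 0"
      using scaled_tail_tendsto[OF G chG x, of "{..-1}"]
      by (simp add: frontier_real_atMost tilted_levy_singleton)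
  qed
  ultimately show ?thesis using C by blast
qed

text \<open>By scaling, the modulus is the exponential of
  \<open>real (Suc n) powr (1 + \<beta>)\<close> times the negative number
  \<open>Re (\<psi> s)\<close>.\<close>

lemma norm_exp_\<psi>_tendsto_0:
  assumes "s \<noteq> 0"
  shows "(\<lambda>n. norm (exp (\<psi> (real (Suc n) * s)))) \<longlonglongrightarrow> 0"
proof -
  have "Re (\<psi> (real (Suc n) * s)) = real (Suc n) powr (1 + \<beta>) * Re (\<psi> s)" for n
    using \<psi>_scale[of "1 / real (Suc n)" s] powr_minus[of "1 / real (Suc n)" "1 + \<beta>"]
    by (simp add: powr_divide mult.commute algebra_simps)
  moreover have "filterlim (\<lambda>n. real (Suc n) powr (1 + \<beta>) * Re (\<psi> s)) at_bot sequentially"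
  proof -
    have "filterlim (\<lambda>n. real (Suc n) powr (1 + \<beta>)) at_top sequentially"
      using \<beta>_pos by real_asymp
    then have "filterlim (\<lambda>n. (- Re (\<psi> s)) * real (Suc n) powr (1 + \<beta>)) at_top sequentially"
      using Re_\<psi>_less_0[OF assms] by (intro filterlim_tendsto_pos_mult_at_top[OF tendsto_const]) auto
    then show ?thesis unfolding filterlim_uminus_at_top by (simp add: mult.commute)
  qed
  ultimately show ?thesis
    using filterlim_compose[OF exp_at_bot] by (simp only: norm_exp_eq_Re)
qed

text \<open>Wiener's lemma: an atom would show up as a non-vanishing mean of the decaying characteristic function.\<close>

lemma stable_no_atoms:
  assumes G: "real_distribution G" and chG: "\<And>s. char G s = exp (\<psi> s)"
  shows "measure G {a} = 0"
proof -
  interpret G: real_distribution G by (rule G)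
  interpret N: prob_space std_normal_distribution by (rule prob_space_std_normal)
  \<comment> \<open>The shift moves the possible atom to 0 and changes the characteristic function
    by a factor of modulus 1.\<close>
  define M where "M = distr G borel (\<lambda>x. x - a)"
  interpret M: real_distribution M unfolding M_def by (rule G.real_distribution_distr) simp
  have chM: "char M s = iexp (- a * s) * exp (\<psi> s)" for s
  proof -
    have "char M s = (CLINT x|G. iexp (- a * s) * iexp (s * x))"
      by (simp add: char_def M_def integral_distr algebra_simps flip: exp_add)
    also have "\<dots> = iexp (- a * s) * char G s"
      unfolding char_def by (rule integral_mult_right_zero)
    finally show ?thesis by (simp only: chG)
  qed
  let ?I = "\<lambda>n. CLINT x|M. (1 - exp (- (real (Suc n) * x)\<^sup>2 / 2)) *\<^sub>R iexp (0 * x)"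
  \<comment> \<open>On one side the Gaussian weights tend to the indicator of the complement of 0,
    so the limit is the mass off the atom.\<close>
  have "?I \<longlonglongrightarrow> (CLINT x|M. complex_of_real (indicator (- {0}) x))"
  proof (rule integral_dominated_convergence[where w = "\<lambda>_. 1"])
    show "AE x in M. (\<lambda>n. (1 - exp (- (real (Suc n) * x)\<^sup>2 / 2)) *\<^sub>R iexp (0 * x))
        \<longlonglongrightarrow> complex_of_real (indicator (- {0}) x)"
    proof (rule AE_I2)
      fix x :: real
      have "(\<lambda>n. 1 - exp (- (real (Suc n) * x)\<^sup>2 / 2)) \<longlonglongrightarrow> indicator (- {0}) x"
      proof (cases "x = 0")
        case False
        then have "(\<lambda>n. 1 - exp (- (real (Suc n) * x)\<^sup>2 / 2)) \<longlonglongrightarrow> 1"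
          by real_asymp
        with False show ?thesis by simp
      qed simp
      then have "(\<lambda>n. complex_of_real (1 - exp (- (real (Suc n) * x)\<^sup>2 / 2))) \<longlonglongrightarrow> complex_of_real (indicator (- {0}) x)"
        by (rule tendsto_of_real)
      then show "(\<lambda>n. (1 - exp (- (real (Suc n) * x)\<^sup>2 / 2)) *\<^sub>R iexp (0 * x))
        \<longlonglongrightarrow> complex_of_real (indicator (- {0}) x)" by (simp add: scaleR_conv_of_real)
    qed
  qed auto
  \<comment> \<open>On the other side the characteristic function decays along the multiples of
    every nonzero \<open>h\<close>, so the limit is 1.\<close>
  moreover have "?I \<longlonglongrightarrow> (CLINT h|std_normal_distribution. 1)"
    unfolding M.char_gaussian_increment[symmetric]
  proof (rule integral_dominated_convergence[where w = "\<lambda>_. 2"])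
    show "AE h in std_normal_distribution. (\<lambda>n. char M 0 - char M (0 + real (Suc n) * h)) \<longlonglongrightarrow> 1"
    proof -
      have "(\<lambda>n. char M 0 - char M (0 + real (Suc n) * h)) \<longlonglongrightarrow> 1" if "h \<noteq> 0" for h
      proof -
        have "(\<lambda>n. char M (real (Suc n) * h)) \<longlonglongrightarrow> 0"
          by (rule tendsto_norm_zero_cancel)
             (use norm_exp_\<psi>_tendsto_0[OF that] in \<open>simp add: chM norm_mult\<close>)
        from tendsto_diff[OF tendsto_const this, of "char M 0"] show ?thesis
          by (simp add: M.char_zero)
      qed
      moreover have "AE h in std_normal_distribution. h \<noteq> (0::real)"
        by (subst AE_density) (auto intro: eventually_mono[OF AE_lborel_singleton[of 0]])
      ultimately show ?thesis by (auto elim: eventually_mono)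
    qed
    have "norm (char M 0 - char M t) \<le> 1 + 1" for t
      by (intro order_trans[OF norm_triangle_ineq4] add_mono M.cmod_char_le_1)
    then show "AE h in std_normal_distribution. norm (char M 0 - char M (0 + real (Suc n) * h)) \<le> 2" for n
      by (simp del: of_nat_Suc)
  qed auto
  ultimately have eq: "(CLINT x|M. complex_of_real (indicator (- {0}) x)) = (CLINT h|std_normal_distribution. 1)"
    by (rule LIMSEQ_unique)
  have "complex_of_real (measure M (- {0})) = (CLINT x|M. complex_of_real (indicator (- {0}) x))"
    by simp
  also have "\<dots> = complex_of_real 1"
    unfolding eq by (simp add: N.prob_space[simplified])
  finally have "measure M (- {0}) = 1" by (simp only: of_real_eq_iff)
  moreover have "measure M (space M - {0}) = 1 - measure M {0}" by (rule M.prob_compl) simp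
  ultimately have "measure M {0} = 0" by (simp add: Compl_eq_Diff_UNIV)
  moreover have "measure M {0} = measure G {a}"
    unfolding M_def by (subst measure_distr) (auto intro!: arg_cong[where f = "measure G"])
  ultimately show ?thesis by simp
qed

end

subsection \<open>Convergence of the normalised sums\<close>

locale power_density = stable_parameters +
  fixes f :: "real \<Rightarrow> real"
  assumes f_measurable [measurable]: "f \<in> borel_measurable borel"
    and f_nonneg: "\<And>x. 0 \<le> f x"
    and f_integrable: "integrable lborel f"
    and f_support: "AE x in lborel. x \<le> 0 \<longrightarrow> f x = 0"
    and f_asymp: "((\<lambda>x. f x / (c * x powr \<beta>)) \<longlongrightarrow> 1) (at_right 0)"
begin

lemma f_le_near_0: "\<exists>\<delta>>0. \<forall>x. 0 < x \<longrightarrow> x < \<delta> \<longrightarrow> f x \<le> 2 * c * x powr \<beta>"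
proof -
  have "\<forall>\<^sub>F x in at_right 0. f x / (c * x powr \<beta>) < 2"
    by (rule order_tendstoD(2)[OF f_asymp]) simp
  then obtain \<delta> where \<delta>: "0 < \<delta>" "\<And>x. 0 < x \<Longrightarrow> x < \<delta> \<Longrightarrow> f x / (c * x powr \<beta>) < 2"
    by (auto simp: eventually_at_right_field)
  have "f x \<le> 2 * c * x powr \<beta>" if x: "0 < x" "x < \<delta>" for x
    using \<delta>(2)[OF x] x c_pos by (simp add: pos_divide_less_eq)
  with \<delta>(1) show ?thesis by blast
qed

text \<open>Finiteness of the mean of the reciprocal: below \<open>\<delta>\<close> the integrand is
  at most \<open>2 * c * x powr (\<beta> - 1)\<close>, integrable as \<beta> > 0, and beyond
  \<open>\<delta>\<close> it is at most \<open>f x / \<delta>\<close>.\<close>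

lemma integrable_f_recip: "integrable lborel (\<lambda>x. f x * (1 / x))"
proof -
  obtain \<delta> where \<delta>: "0 < \<delta>" "\<And>x. 0 < x \<Longrightarrow> x < \<delta> \<Longrightarrow> f x \<le> 2 * c * x powr \<beta>"
    using f_le_near_0 by blast
  have 1: "integrable lborel (\<lambda>x. indicator {0..\<delta>} x *\<^sub>R x powr (\<beta> - 1))"
    using nonnegative_absolutely_integrable_1[OF integrable_on_powr_from_0[of "\<beta> - 1" \<delta>]] \<beta>_pos \<delta>(1)
    by (simp add: set_integrable_def integrable_completion)
  show ?thesis
  proof (rule Bochner_Integration.integrable_bound)
    show "integrable lborel (\<lambda>x. 2 * c * (indicator {0..\<delta>} x *\<^sub>R x powr (\<beta> - 1)) + 1 / \<delta> * f x)"
      by (intro Bochner_Integration.integrable_add integrable_mult_right 1 f_integrable)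
    show "AE x in lborel. norm (f x * (1 / x)) \<le>
        norm (2 * c * (indicator {0..\<delta>} x *\<^sub>R x powr (\<beta> - 1)) + 1 / \<delta> * f x)"
      using f_support
    proof (rule eventually_mono)
      fix x assume supp: "x \<le> 0 \<longrightarrow> f x = 0"
      have nn: "0 \<le> 2 * c * (indicator {0..\<delta>} x *\<^sub>R x powr (\<beta> - 1))" "0 \<le> 1 / \<delta> * f x"
        using c_pos \<delta>(1) f_nonneg by auto
      consider "x \<le> 0" | "0 < x" "x < \<delta>" | "\<delta> \<le> x" by linarith
      then have "norm (f x * (1 / x)) \<le> 2 * c * (indicator {0..\<delta>} x *\<^sub>R x powr (\<beta> - 1)) + 1 / \<delta> * f x"
      proof cases
        case 1 with supp nn show ?thesis by simp
      next
        case 2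
        have "f x * (1 / x) \<le> 2 * c * x powr \<beta> * (1 / x)"
          using 2 \<delta>(2) by (intro mult_right_mono) auto
        also have "\<dots> = 2 * c * (indicator {0..\<delta>} x *\<^sub>R x powr (\<beta> - 1))"
          using 2 by (simp add: powr_diff)
        also have "\<dots> \<le> 2 * c * (indicator {0..\<delta>} x *\<^sub>R x powr (\<beta> - 1)) + 1 / \<delta> * f x"
          using nn by linarith
        finally show ?thesis using 2 f_nonneg[of x] by simp
      next
        case 3
        have "f x * (1 / x) \<le> f x * (1 / \<delta>)"
          using 3 \<delta>(1) f_nonneg by (intro mult_left_mono divide_left_mono) auto
        then show ?thesis using 3 \<delta>(1) f_nonneg[of x] nn by simp
      qed
      then show "norm (f x * (1 / x)) \<le>
        norm (2 * c * (indicator {0..\<delta>} x *\<^sub>R x powr (\<beta> - 1)) + 1 / \<delta> * f x)"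
        by (rule order_trans) simp
    qed
  qed measurable
qed

lemma f_rescaled_tendsto:
  fixes r :: "nat \<Rightarrow> real"
  assumes r: "filterlim r at_top sequentially" "\<And>n. 0 < r n" and v: "0 < v"
  shows "(\<lambda>n. r n powr \<beta> * f (v / r n)) \<longlonglongrightarrow> c * v powr \<beta>"
proof -
  have "(\<lambda>n. v / r n) \<longlonglongrightarrow> 0"
    by (intro tendsto_divide_0[OF tendsto_const] filterlim_at_top_imp_at_infinity r)
  then have "filterlim (\<lambda>n. v / r n) (at_right 0) sequentially"
    using v r(2) by (auto simp: filterlim_at r(2)[THEN less_imp_neq, THEN not_sym] intro!: always_eventually)
  from filterlim_compose[OF f_asymp this]
  have "(\<lambda>n. f (v / r n) / (c * (v / r n) powr \<beta>) * (c * v powr \<beta>)) \<longlonglongrightarrow> 1 * (c * v powr \<beta>)"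
    by (intro tendsto_mult tendsto_const)
  also have "(\<lambda>n. f (v / r n) / (c * (v / r n) powr \<beta>) * (c * v powr \<beta>)) = (\<lambda>n. r n powr \<beta> * f (v / r n))"
    using v r(2) c_pos by (auto simp: fun_eq_iff powr_divide less_imp_le less_imp_neq[THEN not_sym])
  finally show ?thesis by simp
qed

text \<open>Below \<open>\<delta>\<close> the substitution \<open>x = v / r n\<close> costs a factor
  \<open>1 / r n\<close>, and dominated convergence applies with \<open>f_rescaled_tendsto\<close>.
  Above \<open>\<delta>\<close> the integral is of order \<open>r n powr (- 2)\<close>, which beats
  \<open>r n powr (1 + \<beta>)\<close> as \<beta> < 1.\<close>

lemma compensated_integral_tendsto:
  fixes r :: "nat \<Rightarrow> real"
  assumes r: "filterlim r at_top sequentially" "\<And>n. 0 < r n"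
  shows "(\<lambda>n. r n powr (1 + \<beta>) *\<^sub>R (LINT x|lborel. f x *\<^sub>R compensated_iexp (s / (x * r n)))) \<longlonglongrightarrow> \<psi> s"
proof -
  obtain \<delta> where \<delta>: "0 < \<delta>" "\<And>x. 0 < x \<Longrightarrow> x < \<delta> \<Longrightarrow> f x \<le> 2 * c * x powr \<beta>"
    using f_le_near_0 by blast
  let ?k = "\<lambda>n x. compensated_iexp (s / (x * r n))"
  let ?I = "\<lambda>n. LINT x|lborel. f x *\<^sub>R ?k n x"
  let ?f1 = "\<lambda>x. indicator {0<..<\<delta>} x * f x"
  let ?f2 = "\<lambda>x. indicator {\<delta>..} x * f x"
  have bound2: "norm (?f2 x *\<^sub>R ?k n x) \<le> s\<^sup>2 / (2 * \<delta>\<^sup>2) * r n powr (- 2) * f x" for n x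
  proof (cases "\<delta> \<le> x")
    case True
    have "norm (?k n x) \<le> (s / (x * r n))\<^sup>2 / 2" by (rule norm_compensated_iexp_le_square)
    also have "\<dots> = s\<^sup>2 / (2 * (x\<^sup>2 * (r n)\<^sup>2))" by (simp add: power_divide power_mult_distrib)
    also have "\<dots> \<le> s\<^sup>2 / (2 * (\<delta>\<^sup>2 * (r n)\<^sup>2))"
    proof (rule frac_le)
      have "\<delta>\<^sup>2 \<le> x\<^sup>2" using True \<delta>(1) by (intro power_mono) auto
      then show "2 * (\<delta>\<^sup>2 * (r n)\<^sup>2) \<le> 2 * (x\<^sup>2 * (r n)\<^sup>2)" by (intro mult_left_mono mult_right_mono) auto
      have "0 < \<delta>\<^sup>2" "0 < (r n)\<^sup>2" using \<delta>(1) r(2)[of n] by (simp_all only: zero_less_power)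
      then show "0 < 2 * (\<delta>\<^sup>2 * (r n)\<^sup>2)" by simp
    qed simp_all
    also have "\<dots> = s\<^sup>2 / (2 * \<delta>\<^sup>2) * r n powr (- 2)"
      by (simp add: powr_neg_numeral[OF r(2)])
    finally have "f x * norm (?k n x) \<le> f x * (s\<^sup>2 / (2 * \<delta>\<^sup>2) * r n powr (- 2))"
      using f_nonneg by (intro mult_left_mono)
    moreover have "norm (?f2 x *\<^sub>R ?k n x) = f x * norm (?k n x)"
      using True f_nonneg[of x] by simp
    ultimately show ?thesis by (simp only: mult_ac)
  next
    case False then show ?thesis using f_nonneg[of x] by simp
  qed
  have int2: "integrable lborel (\<lambda>x. ?f2 x *\<^sub>R ?k n x)" for n
  proof (rule Bochner_Integration.integrable_bound)
    show "integrable lborel (\<lambda>x. s\<^sup>2 / (2 * \<delta>\<^sup>2) * r n powr (- 2) * f x)"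
      by (intro integrable_mult_right f_integrable)
    show "AE x in lborel. norm (?f2 x *\<^sub>R ?k n x) \<le> norm (s\<^sup>2 / (2 * \<delta>\<^sup>2) * r n powr (- 2) * f x)"
      unfolding real_norm_def by (rule AE_I2, rule order_trans[OF bound2 abs_ge_self])
  qed measurable
  have subst1: "(LINT x|lborel. ?f1 x *\<^sub>R ?k n x) = (1 / r n) *\<^sub>R (LINT v|lborel. ?f1 (v / r n) *\<^sub>R compensated_iexp (s / v))" for n
    using r(2)[of n] by (subst lborel_integral_real_affine[where c = "1 / r n" and t = 0]) auto
  \<comment> \<open>Twice the norm of the limiting integrand; the factor 2 comes from
    \<open>f_le_near_0\<close>.\<close>
  define w where "w v = 2 * norm ((indicator {0<..} v * (c * v powr \<beta>)) *\<^sub>R compensated_iexp (s / v))" for v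
  have w_int: "integrable lborel w"
    unfolding w_def using integrable_compensated[of s]
    by (intro integrable_mult_right integrable_norm) (simp add: integrable_\<nu>)
  have w_bound: "norm ((r n powr \<beta> * ?f1 (v / r n)) *\<^sub>R compensated_iexp (s / v)) \<le> w v" for n v
  proof (cases "v / r n \<in> {0<..<\<delta>}")
    case True
    then have v: "0 < v" using r(2)[of n] by (simp add: zero_less_divide_iff)
    have "r n powr \<beta> * f (v / r n) \<le> r n powr \<beta> * (2 * c * (v / r n) powr \<beta>)"
      using True \<delta>(2) by (intro mult_left_mono) auto
    also have "\<dots> = 2 * (c * v powr \<beta>)"
      using v r(2)[of n] by (simp add: powr_divide)
    finally have "r n powr \<beta> * f (v / r n) \<le> 2 * (c * v powr \<beta>)" .
    then have "r n powr \<beta> * f (v / r n) * norm (compensated_iexp (s / v)) \<le> 2 * (c * v powr \<beta>) * norm (compensated_iexp (s / v))"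
      by (rule mult_right_mono) simp
    then show ?thesis using True v c_pos f_nonneg by (simp add: w_def)
  next
    case False then show ?thesis by (simp add: w_def)
  qed
  have scaled_int: "integrable lborel (\<lambda>v. (r n powr \<beta> * ?f1 (v / r n)) *\<^sub>R compensated_iexp (s / v))" for n
    by (rule Bochner_Integration.integrable_bound[OF w_int], measurable)
       (unfold real_norm_def, rule AE_I2, rule order_trans[OF w_bound abs_ge_self])
  have int1: "integrable lborel (\<lambda>x. ?f1 x *\<^sub>R ?k n x)" for n
  proof -
    have "integrable lborel (\<lambda>v. (1 / r n powr \<beta>) *\<^sub>R ((r n powr \<beta> * ?f1 (v / r n)) *\<^sub>R compensated_iexp (s / v)))"
      by (rule integrable_scaleR_right[OF scaled_int])
    then have "integrable lborel (\<lambda>v. ?f1 (v / r n) *\<^sub>R compensated_iexp (s / v))"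
      using r(2)[of n] by simp
    from lborel_integrable_real_affine[OF this, of "r n" 0] show ?thesis
      using r(2)[of n] by (simp add: mult.commute)
  qed
  have split: "?I n = (LINT x|lborel. ?f1 x *\<^sub>R ?k n x) + (LINT x|lborel. ?f2 x *\<^sub>R ?k n x)" for n
  proof -
    have "?I n = (LINT x|lborel. ?f1 x *\<^sub>R ?k n x + ?f2 x *\<^sub>R ?k n x)"
    proof (rule integral_cong_AE)
      show "AE x in lborel. f x *\<^sub>R ?k n x = ?f1 x *\<^sub>R ?k n x + ?f2 x *\<^sub>R ?k n x"
        using f_support
      proof (rule eventually_mono)
        fix x assume "x \<le> 0 \<longrightarrow> f x = 0"
        then show "f x *\<^sub>R ?k n x = ?f1 x *\<^sub>R ?k n x + ?f2 x *\<^sub>R ?k n x"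
          using \<delta>(1) by (cases "x \<le> 0"; cases "x < \<delta>") auto
      qed
    qed measurable
    then show ?thesis by (simp only: Bochner_Integration.integral_add[OF int1 int2])
  qed
  have "(\<lambda>n. LINT v|lborel. (r n powr \<beta> * ?f1 (v / r n)) *\<^sub>R compensated_iexp (s / v))
     \<longlonglongrightarrow> (LINT v|lborel. (indicator {0<..} v * (c * v powr \<beta>)) *\<^sub>R compensated_iexp (s / v))"
  proof (rule integral_dominated_convergence[where w = w])
    show "AE v in lborel. (\<lambda>n. (r n powr \<beta> * ?f1 (v / r n)) *\<^sub>R compensated_iexp (s / v))
      \<longlonglongrightarrow> (indicator {0<..} v * (c * v powr \<beta>)) *\<^sub>R compensated_iexp (s / v)"
    proof (rule AE_I2)
      fix v :: real
      have "(\<lambda>n. r n powr \<beta> * ?f1 (v / r n)) \<longlonglongrightarrow> indicator {0<..} v * (c * v powr \<beta>)"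
      proof (cases "0 < v")
        case True
        have "\<forall>\<^sub>F n in sequentially. v / \<delta> < r n"
          using r(1) by (auto simp: filterlim_at_top_dense)
        then have ev: "\<forall>\<^sub>F n in sequentially. r n powr \<beta> * f (v / r n) = r n powr \<beta> * ?f1 (v / r n)"
        proof (rule eventually_mono)
          fix n assume "v / \<delta> < r n"
          then have "v / r n < \<delta>" using \<delta>(1) r(2)[of n] by (simp add: field_simps)
          then show "r n powr \<beta> * f (v / r n) = r n powr \<beta> * ?f1 (v / r n)"
            using True r(2)[of n] by simp
        qed
        show ?thesis
          using Lim_transform_eventually[OF f_rescaled_tendsto[OF r True] ev] True by simp
      next
        case False
        then have "v / r n \<le> 0" for n using r(2)[of n] by (simp add: divide_nonpos_pos)
        then have "?f1 (v / r n) = 0" for n by (simp add: not_less)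
        then have zero: "(\<lambda>n. r n powr \<beta> * ?f1 (v / r n)) = (\<lambda>_. 0)" by (simp only: mult_zero_right)
        show ?thesis unfolding zero using False by simp
      qed
      then show "(\<lambda>n. (r n powr \<beta> * ?f1 (v / r n)) *\<^sub>R compensated_iexp (s / v))
      \<longlonglongrightarrow> (indicator {0<..} v * (c * v powr \<beta>)) *\<^sub>R compensated_iexp (s / v)"
        by (rule tendsto_scaleR[OF _ tendsto_const])
    qed
  qed (use w_int w_bound in auto)
  also have "(LINT v|lborel. (indicator {0<..} v * (c * v powr \<beta>)) *\<^sub>R compensated_iexp (s / v)) = \<psi> s"
    unfolding stable_exponent_def by (rule integral_\<nu>[symmetric]) measurable
  also have "(\<lambda>n. LINT v|lborel. (r n powr \<beta> * ?f1 (v / r n)) *\<^sub>R compensated_iexp (s / v)) =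
      (\<lambda>n. r n powr (1 + \<beta>) *\<^sub>R (LINT x|lborel. ?f1 x *\<^sub>R ?k n x))"
  proof
    fix n
    have "(LINT v|lborel. (r n powr \<beta> * ?f1 (v / r n)) *\<^sub>R compensated_iexp (s / v)) =
        r n powr \<beta> *\<^sub>R (LINT v|lborel. ?f1 (v / r n) *\<^sub>R compensated_iexp (s / v))"
      by (simp only: scaleR_scaleR[symmetric] integral_scaleR_right)
    then show "(LINT v|lborel. (r n powr \<beta> * ?f1 (v / r n)) *\<^sub>R compensated_iexp (s / v)) =
        r n powr (1 + \<beta>) *\<^sub>R (LINT x|lborel. ?f1 x *\<^sub>R ?k n x)"
      unfolding subst1 using r(2)[of n] by (simp only: scaleR_scaleR) (simp add: powr_add)
  qed
  finally have lim1: "(\<lambda>n. r n powr (1 + \<beta>) *\<^sub>R (LINT x|lborel. ?f1 x *\<^sub>R ?k n x)) \<longlonglongrightarrow> \<psi> s" .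
  have lim2: "(\<lambda>n. r n powr (1 + \<beta>) *\<^sub>R (LINT x|lborel. ?f2 x *\<^sub>R ?k n x)) \<longlonglongrightarrow> 0"
  proof (rule Lim_null_comparison[OF always_eventually[OF allI]])
    fix n
    have "norm (LINT x|lborel. ?f2 x *\<^sub>R ?k n x) \<le> (LINT x|lborel. s\<^sup>2 / (2 * \<delta>\<^sup>2) * r n powr (- 2) * f x)"
      by (rule order_trans[OF integral_norm_bound integral_mono])
         (intro integrable_norm int2 integrable_mult_right f_integrable bound2)+
    also have "\<dots> = s\<^sup>2 / (2 * \<delta>\<^sup>2) * r n powr (- 2) * (LINT x|lborel. f x)"
      by (rule integral_mult_right_zero)
    finally have "norm (r n powr (1 + \<beta>) *\<^sub>R (LINT x|lborel. ?f2 x *\<^sub>R ?k n x)) \<le>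
        r n powr (1 + \<beta>) * (s\<^sup>2 / (2 * \<delta>\<^sup>2) * r n powr (- 2) * (LINT x|lborel. f x))"
      unfolding norm_scaleR abs_of_nonneg[OF powr_ge_zero] by (intro mult_left_mono powr_ge_zero)
    also have "\<dots> = s\<^sup>2 / (2 * \<delta>\<^sup>2) * (LINT x|lborel. f x) * (r n powr (1 + \<beta>) * r n powr (- 2))"
      by (simp only: mult_ac)
    also have "r n powr (1 + \<beta>) * r n powr (- 2) = r n powr (\<beta> - 1)"
      by (subst powr_add[symmetric]) simp
    finally show "norm (r n powr (1 + \<beta>) *\<^sub>R (LINT x|lborel. ?f2 x *\<^sub>R ?k n x)) \<le>
        s\<^sup>2 / (2 * \<delta>\<^sup>2) * (LINT x|lborel. f x) * r n powr (\<beta> - 1)" .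
  next
    show "(\<lambda>n. s\<^sup>2 / (2 * \<delta>\<^sup>2) * (LINT x|lborel. f x) * r n powr (\<beta> - 1)) \<longlonglongrightarrow> 0"
      using \<beta>_less_1 by (intro tendsto_mult_right_zero tendsto_neg_powr r) auto
  qed
  show ?thesis
    using tendsto_add[OF lim1 lim2] by (simp only: split scaleR_add_right add_0_right)
qed

end

text \<open>The centring is put into the base \<open>w n\<close>. With \<open>N = Suc n\<close>,
  both \<open>w n\<close> and \<open>exp (z / N)\<close> have norm at most 1, so their
  \<open>N\<close>-th powers differ by at most \<open>N * norm (w n - exp (z / N))\<close>. This
  avoids complex logarithms.\<close>

lemma centered_char_power_tendsto:
  fixes D :: "real measure" and r :: "nat \<Rightarrow> real"
  assumes D: "real_distribution D"
    and r: "\<And>n. r n = real (Suc n) powr (1 / \<alpha>)" and \<alpha>: "0 < \<alpha>" "\<alpha> < 2"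
    and lim: "(\<lambda>n. real (Suc n) *\<^sub>R (char D (s / r n) - 1 - \<i> * complex_of_real (s / r n * m))) \<longlonglongrightarrow> z"
    and z: "Re z \<le> 0"
  shows "(\<lambda>n. iexp (- (real (Suc n) * (s / r n * m))) * char D (s / r n) ^ Suc n) \<longlonglongrightarrow> exp z"
proof -
  interpret D: real_distribution D by (rule D)
  define u where "u n = s / r n * m" for n
  define w where "w n = iexp (- u n) * char D (s / r n)" for n
  let ?N = "\<lambda>n. real (Suc n)"
  \<comment> \<open>Centring inside the base costs only a second-order error, the compensated
    exponential of the number \<open>u n\<close>.\<close>
  have eq: "?N n *\<^sub>R (w n - 1) =
      iexp (- u n) * (?N n *\<^sub>R (char D (s / r n) - 1 - \<i> * complex_of_real (u n)))
        - iexp (- u n) * (?N n *\<^sub>R compensated_iexp (u n))" for n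
  proof -
    have "iexp (- u n) * iexp (u n) = 1" by (simp flip: exp_add)
    then show ?thesis
      by (simp add: w_def compensated_iexp_def scaleR_conv_of_real algebra_simps)
  qed
  \<comment> \<open>The order is \<open>?N n powr (1 - 2 / \<alpha>)\<close>, which vanishes because
    \<alpha> < 2.\<close>
  have u2: "(\<lambda>n. ?N n * (u n)\<^sup>2) \<longlonglongrightarrow> 0"
  proof -
    have "?N n * (u n)\<^sup>2 = (s * m)\<^sup>2 * ?N n powr (1 - 2 / \<alpha>)" for n
      by (simp add: u_def r power_divide power_mult_distrib powr_diff powr_power del: of_nat_Suc)
    moreover have "(\<lambda>n. (s * m)\<^sup>2 * ?N n powr (1 - 2 / \<alpha>)) \<longlonglongrightarrow> 0"
    proof (intro tendsto_mult_right_zero tendsto_neg_powr)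
      show "1 - 2 / \<alpha> < 0" using \<alpha> by simp
      show "filterlim ?N at_top sequentially" by real_asymp
    qed
    ultimately show ?thesis by simp
  qed
  have "u \<longlonglongrightarrow> 0"
  proof -
    have "(\<lambda>n. (s * m) * ?N n powr (- (1 / \<alpha>))) \<longlonglongrightarrow> 0"
    proof (intro tendsto_mult_right_zero tendsto_neg_powr)
      show "- (1 / \<alpha>) < 0" using \<alpha> by simp
      show "filterlim ?N at_top sequentially" by real_asymp
    qed
    then show ?thesis by (simp add: u_def[abs_def] r powr_minus divide_inverse mult_ac del: of_nat_Suc)
  qed
  then have iexp_lim: "(\<lambda>n. iexp (- u n)) \<longlonglongrightarrow> 1"
    by (auto intro!: tendsto_eq_intros)
  have "(\<lambda>n. iexp (- u n) * (?N n *\<^sub>R compensated_iexp (u n))) \<longlonglongrightarrow> 0"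
  proof (rule Lim_null_comparison[OF always_eventually[OF allI]])
    show "norm (iexp (- u n) * (?N n *\<^sub>R compensated_iexp (u n))) \<le> ?N n * (u n)\<^sup>2" for n
    proof -
      have "norm (compensated_iexp (u n)) \<le> (u n)\<^sup>2"
        using norm_compensated_iexp_le_square[of "u n"] zero_le_power2[of "u n"] by linarith
      then have "?N n * norm (compensated_iexp (u n)) \<le> ?N n * (u n)\<^sup>2" by (intro mult_left_mono) auto
      then show ?thesis by (simp add: norm_mult del: of_nat_Suc of_real_minus)
    qed
  qed (rule u2)
  from tendsto_diff[OF tendsto_mult[OF iexp_lim lim] this]
  have lim_w: "(\<lambda>n. ?N n *\<^sub>R (w n - 1)) \<longlonglongrightarrow> z"
    unfolding eq u_def by simp
  have "(\<lambda>n. (1 / (1 / ?N n)) *\<^sub>R (exp ((1 / ?N n) *\<^sub>R z) - 1)) \<longlonglongrightarrow> z"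
    by (rule exp_scaled_increment_tendsto) (real_asymp, simp)
  then have lim_e: "(\<lambda>n. ?N n *\<^sub>R (exp ((1 / ?N n) *\<^sub>R z) - 1)) \<longlonglongrightarrow> z" by simp
  have norm_w: "norm (w n) \<le> 1" for n
    using D.cmod_char_le_1 by (simp add: w_def norm_mult del: of_real_minus)
  have norm_e: "norm (exp ((1 / ?N n) *\<^sub>R z)) \<le> 1" for n
    using z by (simp add: mult_nonneg_nonpos divide_nonpos_pos)
  have exp_pow: "exp ((1 / ?N n) *\<^sub>R z) ^ Suc n = exp z" for n
    by (subst exp_of_nat_mult[symmetric]) (simp add: scaleR_conv_of_real del: of_nat_Suc)
  have "(\<lambda>n. w n ^ Suc n - exp z) \<longlonglongrightarrow> 0"
  proof (rule Lim_null_comparison[OF always_eventually[OF allI]])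
    fix n
    have "norm (w n ^ Suc n - exp ((1 / ?N n) *\<^sub>R z) ^ Suc n) \<le> ?N n * norm (w n - exp ((1 / ?N n) *\<^sub>R z))"
      by (rule norm_power_diff[OF norm_w norm_e])
    also have "\<dots> = norm (?N n *\<^sub>R (w n - exp ((1 / ?N n) *\<^sub>R z)))" by simp
    also have "?N n *\<^sub>R (w n - exp ((1 / ?N n) *\<^sub>R z)) =
        ?N n *\<^sub>R (w n - 1) - ?N n *\<^sub>R (exp ((1 / ?N n) *\<^sub>R z) - 1)"
      by (simp add: scaleR_diff_right)
    finally show "norm (w n ^ Suc n - exp z) \<le>
      norm (?N n *\<^sub>R (w n - 1) - ?N n *\<^sub>R (exp ((1 / ?N n) *\<^sub>R z) - 1))" by (simp only: exp_pow)
  next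
    show "(\<lambda>n. norm (?N n *\<^sub>R (w n - 1) - ?N n *\<^sub>R (exp ((1 / ?N n) *\<^sub>R z) - 1))) \<longlonglongrightarrow> 0"
      using tendsto_norm[OF tendsto_diff[OF lim_w lim_e]] by simp
  qed
  then have "(\<lambda>n. w n ^ Suc n) \<longlonglongrightarrow> exp z" by (simp only: LIM_zero_iff)
  moreover have "w n ^ Suc n = iexp (- (?N n * (s / r n * m))) * char D (s / r n) ^ Suc n" for n
    unfolding w_def power_mult_distrib
    by (subst exp_of_nat_mult[symmetric]) (simp add: u_def algebra_simps)
  ultimately show ?thesis by simp
qed

lemma (in prob_space) char_affine_iid_sum:
  assumes indep: "indep_vars (\<lambda>_. borel) Y UNIV" and law: "\<And>i. distr M borel (Y i) = D"
  shows "char (distr M borel (\<lambda>\<omega>. a * (\<Sum>i<n::nat. Y i \<omega>) - b)) t = iexp (- (t * b)) * char D (a * t) ^ n"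
proof -
  have [measurable]: "random_variable borel (Y i)" for i
    using indep unfolding indep_vars_def2 by simp
  have "char (distr M borel (\<lambda>\<omega>. a * (\<Sum>i<n. Y i \<omega>) - b)) t =
      (CLINT \<omega>|M. iexp (- (t * b)) * iexp (a * t * (\<Sum>i<n. Y i \<omega>)))"
    by (simp add: char_def integral_distr algebra_simps flip: exp_add)
  also have "\<dots> = iexp (- (t * b)) * (CLINT \<omega>|M. iexp (a * t * (\<Sum>i<n. Y i \<omega>)))"
    by (rule integral_mult_right_zero)
  also have "(CLINT \<omega>|M. iexp (a * t * (\<Sum>i<n. Y i \<omega>))) = char (distr M borel (\<lambda>\<omega>. \<Sum>i<n. Y i \<omega>)) (a * t)"
    unfolding char_def by (subst integral_distr) auto
  also have "\<dots> = (\<Prod>i<n. char (distr M borel (Y i)) (a * t))"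
    by (rule char_distr_sum[OF indep_vars_subset[OF indep]]) auto
  also have "\<dots> = char D (a * t) ^ n" by (simp add: law)
  finally show ?thesis .
qed

subsection \<open>The limit laws\<close>

text \<open>Skorohod's representation turns weak convergence into pointwise convergence on one
  space, where \<open>lim\<close> applies; bounded convergence then handles the characteristic
  functions. The maps vary with \<open>n\<close>, as the delta method requires.\<close>

lemma weak_conv_extended_mapping:
  fixes \<mu> :: "nat \<Rightarrow> real measure" and g :: "nat \<Rightarrow> real \<Rightarrow> real"
  assumes rd: "\<And>n. real_distribution (\<mu> n)" and M: "real_distribution M" and wc: "weak_conv_m \<mu> M"
    and g [measurable]: "\<And>n. g n \<in> borel_measurable borel" and h [measurable]: "h \<in> borel_measurable borel"
    and lim: "\<And>z zs. zs \<longlonglongrightarrow> z \<Longrightarrow> (\<lambda>n. g n (zs n)) \<longlonglongrightarrow> h z"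
  shows "weak_conv_m (\<lambda>n. distr (\<mu> n) borel (g n)) (distr M borel h)"
proof -
  interpret \<mu>: real_distribution "\<mu> n" for n by (rule rd)
  interpret M: real_distribution M by (rule M)
  obtain \<Omega> :: "real measure" and Z Z' where \<Omega>: "prob_space \<Omega>"
    and Z [measurable]: "\<And>n. Z n \<in> borel_measurable \<Omega>" and dZ: "\<And>n. distr \<Omega> borel (Z n) = \<mu> n"
    and Z' [measurable]: "Z' \<in> borel_measurable \<Omega>" and dZ': "distr \<Omega> borel Z' = M"
    and ZZ': "\<And>x. x \<in> space \<Omega> \<Longrightarrow> (\<lambda>n. Z n x) \<longlonglongrightarrow> Z' x"
    using Skorohod[OF rd M wc] by force
  interpret \<Omega>: prob_space \<Omega> by (rule \<Omega>)
  show ?thesis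
  proof (rule levy_continuity)
    fix t
    have "(\<lambda>n. CLINT x|\<Omega>. iexp (t * g n (Z n x))) \<longlonglongrightarrow> (CLINT x|\<Omega>. iexp (t * h (Z' x)))"
      by (rule integral_dominated_convergence[where w = "\<lambda>_. 1"])
         (auto intro!: AE_I2 tendsto_intros lim ZZ' simp del: of_real_mult)
    then show "(\<lambda>n. char (distr (\<mu> n) borel (g n)) t) \<longlonglongrightarrow> char (distr M borel h) t"
      by (simp add: char_def integral_distr flip: dZ dZ')
  qed (auto intro!: \<mu>.real_distribution_distr M.real_distribution_distr)
qed

text \<open>\<open>stable_law\<close> asks for summands on a space over
  \<open>nat \<Rightarrow> real\<close>; the coordinates of the infinite product of \<open>D\<close>
  provide them.\<close>

lemma stable_law_of_char_limit:
  assumes \<alpha>: "0 < \<alpha>" "\<alpha> \<le> 2" and D: "real_distribution D"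
    and G: "real_distribution G" and nondeg: "nondegenerate G"
    and lim: "\<And>t. (\<lambda>n. iexp (- (t * b n)) * char D (real n powr (- 1 / \<alpha>) * t) ^ n) \<longlonglongrightarrow> char G t"
  shows "stable_law \<alpha> G"
proof -
  interpret D: real_distribution D by (rule D)
  define P :: "(nat \<Rightarrow> real) measure" where "P = PiM UNIV (\<lambda>_. D)"
  interpret P: prob_space P unfolding P_def by (rule prob_space_PiM) (rule D.prob_space_axioms)
  have sets_P: "sets P = sets (PiM UNIV (\<lambda>_. borel))"
    unfolding P_def by (rule sets_PiM_cong) simp_all
  have meas [measurable]: "(\<lambda>\<omega>. \<omega> i) \<in> borel_measurable P" for i
    unfolding measurable_cong_sets[OF sets_P refl] by measurable
  have law: "distr P borel (\<lambda>\<omega>. \<omega> i) = D" for i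
  proof -
    have "distr P borel (\<lambda>\<omega>. \<omega> i) = distr P D (\<lambda>\<omega>. \<omega> i)" by (rule distr_cong) simp_all
    also have "\<dots> = D" unfolding P_def by (rule distr_PiM_component) (simp_all add: D.prob_space_axioms)
    finally show ?thesis .
  qed
  have indep: "P.indep_vars (\<lambda>_. borel) (\<lambda>i \<omega>. \<omega> i) UNIV"
  proof (subst P.indep_vars_iff_distr_eq_PiM')
    show "distr P (PiM UNIV (\<lambda>_. borel)) (\<lambda>x. \<lambda>i\<in>UNIV. x i) = PiM UNIV (\<lambda>i. distr P borel (\<lambda>\<omega>. \<omega> i))"
      unfolding restrict_UNIV law distr_id2[OF sets_P[symmetric]] by (rule P_def)
  qed auto
  have "weak_conv_m (\<lambda>n. distr P borel (\<lambda>\<omega>. real n powr (- 1 / \<alpha>) * (\<Sum>i<n. \<omega> i) - b n)) G"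
  proof (rule levy_continuity[OF _ G])
    show "real_distribution (distr P borel (\<lambda>\<omega>. real n powr (- 1 / \<alpha>) * (\<Sum>i<n. \<omega> i) - b n))" for n
      by (rule P.real_distribution_distr) measurable
    show "(\<lambda>n. char (distr P borel (\<lambda>\<omega>. real n powr (- 1 / \<alpha>) * (\<Sum>i<n. \<omega> i) - b n)) t) \<longlonglongrightarrow> char G t" for t
      unfolding P.char_affine_iid_sum[OF indep law] by (rule lim)
  qed
  then show ?thesis
    unfolding stable_law_def using \<alpha> G nondeg P.prob_space_axioms indep law
    by (intro conjI exI[of _ P] exI[of _ "\<lambda>i \<omega>. \<omega> i"] exI[of _ b]) auto
qed

text \<open>The delta method for the reciprocal: with
  \<open>h = zs n * real n powr (- \<gamma>)\<close>, the difference of reciprocals is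
  \<open>- h / ((E + h) * E)\<close>.\<close>

lemma reciprocal_shift_tendsto:
  fixes E \<gamma> z :: real
  assumes E: "0 < E" and \<gamma>: "0 < \<gamma>" and z: "zs \<longlonglongrightarrow> z"
  shows "(\<lambda>n. real n powr \<gamma> * (1 / (E + zs n * real n powr (- \<gamma>)) - 1 / E)) \<longlonglongrightarrow> - z / E\<^sup>2"
proof -
  have "(\<lambda>n. real n powr (- \<gamma>)) \<longlonglongrightarrow> 0"
    using \<gamma> filterlim_real_sequentially by (intro tendsto_neg_powr) auto
  from tendsto_add[OF tendsto_const tendsto_mult[OF z this], of E]
  have den: "(\<lambda>n. E + zs n * real n powr (- \<gamma>)) \<longlonglongrightarrow> E" by simp
  then have ev: "\<forall>\<^sub>F n in sequentially. 0 < E + zs n * real n powr (- \<gamma>)"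
    using E by (rule order_tendstoD)
  have *: "(\<lambda>n. - zs n / ((E + zs n * real n powr (- \<gamma>)) * E)) \<longlonglongrightarrow> - z / (E * E)"
    using E by (intro tendsto_intros z den) auto
  have "\<forall>\<^sub>F n in sequentially. - zs n / ((E + zs n * real n powr (- \<gamma>)) * E) =
      real n powr \<gamma> * (1 / (E + zs n * real n powr (- \<gamma>)) - 1 / E)"
    \<comment> \<open>Positive \<open>n\<close> is required because \<open>0 powr \<gamma>\<close>
      is 0.\<close>
    using ev eventually_gt_at_top[of 0]
  proof eventually_elim
    case (elim n)
    define p where "p = real n powr \<gamma>"
    have p: "real n powr (- \<gamma>) = 1 / p" "p \<noteq> 0"
      using elim(2) by (simp_all add: p_def powr_minus_divide)
    have "1 / (E + zs n * (1 / p)) - 1 / E = (E - (E + zs n * (1 / p))) / ((E + zs n * (1 / p)) * E)"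
      using elim(1) E unfolding p by (subst diff_frac_eq) auto
    then show ?case unfolding p p_def[symmetric] using p(2) by simp
  qed
  from Lim_transform_eventually[OF * this] show ?thesis by (simp add: power2_eq_square)
qed

theorem theoremK:
  fixes M :: "'a measure"
    and X :: "nat \<Rightarrow> 'a \<Rightarrow> real"
    and f :: "real \<Rightarrow> real"
    and c \<alpha> \<beta> \<E> :: real
  assumes "prob_space M"
    and "prob_space.indep_vars M (\<lambda>_. borel) X UNIV"
    and "\<And>i. AE \<omega> in M. X i \<omega> \<in> {0..1}"
    and "\<And>x. f x \<ge> 0"
    and "\<And>i. distributed M lborel (X i) (\<lambda>x. ennreal (f x))"
    and "c > 0"
    and "((\<lambda>x. f x / (c * x powr \<beta>)) \<longlongrightarrow> 1) (at_right 0)"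
    and "\<alpha> = 1 + \<beta>"
    and "\<alpha> > 1"
    and "\<alpha> < 2"
    and "\<E> = prob_space.expectation M (\<lambda>\<omega>. 1 / X 0 \<omega>)"
  shows "\<exists>G. unbalanced_stable_law \<alpha> G \<and>
    weak_conv_m
      (\<lambda>n. distr M borel
        (\<lambda>\<omega>. real n powr (1 - 1 / \<alpha>) * (1 / harmonic_mean n (\<lambda>i. X i \<omega>) - \<E>))) G \<and>
    (\<exists>N. real_distribution N \<and>
      (\<forall>x. cdf N x = 1 - cdf G (- x * \<E>\<^sup>2)) \<and>
      weak_conv_m
        (\<lambda>n. distr M borel
          (\<lambda>\<omega>. real n powr (1 - 1 / \<alpha>) * (harmonic_mean n (\<lambda>i. X i \<omega>) - 1 / \<E>))) N)"
proof -
  interpret prob_space M by (rule assms(1))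
  note indep = assms(2) and X01 = assms(3) and f0 = assms(4) and dist = assms(5)
  have \<beta>: "0 < \<beta>" "\<beta> < 1" "1 + \<beta> = \<alpha>" using assms(8-10) by simp_all
  have X_meas [measurable]: "random_variable borel (X i)" for i
    using indep unfolding indep_vars_def2 by simp
  have f_meas [measurable]: "f \<in> borel_measurable borel"
    using distributed_real_measurable[OF _ dist] f0 by simp
  have law_X: "distr M borel (X i) = density lborel (\<lambda>x. ennreal (f x))" for i
    using dist[of i] by (subst distributed_distr_eq_density[symmetric]) (auto intro!: distr_cong)
  have f_int: "integrable lborel f" and f_total: "(LINT x|lborel. f x) = 1"
    using distributed_integrable[OF dist, of "\<lambda>_. 1" 0] distributed_integral[OF dist, of "\<lambda>_. 1" 0] f0
    by (simp_all add: prob_space)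
  have "AE x in distr M borel (X 0). x \<in> {0..1}"
    using X01[of 0] by (subst AE_distr_iff) auto
  then have "AE x in lborel. 0 < f x \<longrightarrow> x \<in> {0..1}"
    unfolding law_X by (subst (asm) AE_density) auto
  \<comment> \<open>The range of \<open>X 0\<close> excludes negative \<open>x\<close> only; the
    point 0 is discarded as a null set.\<close>
  with AE_lborel_singleton[of 0] have f_supp: "AE x in lborel. x \<le> 0 \<longrightarrow> f x = 0"
  proof eventually_elim
    case (elim x) then show ?case using f0[of x] by (cases "f x = 0") auto
  qed
  interpret power_density c \<beta> f
    by unfold_locales (use assms(6) \<beta> f_meas f0 f_int f_supp assms(7) in auto)

  \<comment> \<open>Law, mean and characteristic function of a reciprocal\<close>
  define D where "D = distr M borel (\<lambda>\<omega>. 1 / X 0 \<omega>)"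
  interpret D: real_distribution D unfolding D_def by (rule real_distribution_distr) simp
  have law_Y: "distr M borel (\<lambda>\<omega>. 1 / X i \<omega>) = D" for i
  proof -
    have "distr M borel (\<lambda>\<omega>. 1 / X j \<omega>) = distr (density lborel (\<lambda>x. ennreal (f x))) borel (\<lambda>x. 1 / x)" for j
      unfolding law_X[symmetric, of j] by (subst distr_distr) (auto simp: comp_def)
    then show ?thesis by (simp add: D_def)
  qed
  have indep_Y: "indep_vars (\<lambda>_. borel) (\<lambda>i \<omega>. 1 / X i \<omega>) UNIV"
    by (rule indep_vars_compose2[OF indep]) simp
  have \<E>_eq: "\<E> = (LINT x|lborel. f x * (1 / x))"
    unfolding assms(11) by (rule distributed_integral[OF dist, symmetric]) (auto simp: f0)
  have char_D: "char D t = (CLINT x|lborel. f x *\<^sub>R iexp (t * (1 / x)))" for t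
  proof -
    have "char D t = (CLINT x|distr M borel (X 0). iexp (t * (1 / x)))"
      unfolding char_def D_def by (subst (1 2) integral_distr) auto
    then show ?thesis unfolding law_X by (subst (asm) integral_density) (auto simp: f0)
  qed
  have \<E>_pos: "0 < \<E>"
  proof -
    have nn: "AE x in lborel. 0 \<le> f x * (1 / x)"
      using f_supp by eventually_elim (use f0 in \<open>simp add: zero_le_divide_iff, metis linear\<close>)
    \<comment> \<open>A zero mean would force \<open>f\<close> to vanish almost everywhere, against
      its total mass 1.\<close>
    have "\<E> \<noteq> 0"
    proof
      assume "\<E> = 0"
      then have "AE x in lborel. f x * (1 / x) = 0"
        unfolding \<E>_eq by (subst (asm) integral_nonneg_eq_0_iff_AE[OF integrable_f_recip nn])
      with f_supp have "AE x in lborel. f x = 0" by eventually_elim auto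
      then have "(LINT x|lborel. f x) = 0" by (rule integral_eq_zero_AE)
      then show False using f_total by simp
    qed
    moreover have "0 \<le> \<E>" unfolding \<E>_eq by (rule integral_nonneg_AE[OF nn])
    ultimately show ?thesis by simp
  qed

  \<comment> \<open>The centring \<open>real n * \<E>\<close> of the sum, rescaled by
    \<open>real n powr (- 1 / \<alpha>)\<close>.\<close>
  define b where "b n = real n powr (1 - 1 / \<alpha>) * \<E>" for n
  have char_lim: "(\<lambda>n. iexp (- (t * b n)) * char D (real n powr (- 1 / \<alpha>) * t) ^ n) \<longlonglongrightarrow> exp (\<psi> t)" for t
  proof -
    \<comment> \<open>The index starts at 1 to keep \<open>r\<close> positive;
      \<open>LIMSEQ_imp_Suc\<close> undoes the shift at the end.\<close>
    define r where "r n = real (Suc n) powr (1 / \<alpha>)" for n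
    have r_pos: "0 < r n" for n by (simp add: r_def)
    have r_top: "filterlim r at_top sequentially"
      unfolding r_def using assms(9) by real_asymp
    have r_pow: "r n powr (1 + \<beta>) = real (Suc n)" for n
      using assms(9) by (simp add: r_def powr_powr \<beta>(3))
    \<comment> \<open>The constant and linear terms of \<open>compensated_iexp\<close> integrate to
      the total mass 1 and the mean \<E>.\<close>
    have eq: "char D (t / r n) - 1 - \<i> * complex_of_real (t / r n * \<E>) =
        (LINT x|lborel. f x *\<^sub>R compensated_iexp (t / (x * r n)))" for n
    proof -
      have i1: "integrable lborel (\<lambda>x. f x *\<^sub>R iexp (t / r n * (1 / x)))"
        by (rule Bochner_Integration.integrable_bound[OF f_int]) (auto simp: f0 simp del: of_real_mult)
      have i2: "integrable lborel (\<lambda>x. complex_of_real (f x))"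
        by (rule integrable_of_real[OF f_int])
      have i3: "integrable lborel (\<lambda>x. \<i> * complex_of_real (t / r n) * complex_of_real (f x * (1 / x)))"
        by (intro integrable_mult_right integrable_of_real integrable_f_recip)
      have "(LINT x|lborel. f x *\<^sub>R compensated_iexp (t / (x * r n))) =
          (CLINT x|lborel. f x *\<^sub>R iexp (t / r n * (1 / x)) - complex_of_real (f x)
            - \<i> * complex_of_real (t / r n) * complex_of_real (f x * (1 / x)))"
        by (intro Bochner_Integration.integral_cong refl)
           (simp add: compensated_iexp_def scaleR_conv_of_real algebra_simps)
      also have "\<dots> = char D (t / r n) - (CLINT x|lborel. complex_of_real (f x))
          - (CLINT x|lborel. \<i> * complex_of_real (t / r n) * complex_of_real (f x * (1 / x)))"
        by (simp only: Bochner_Integration.integral_diff i1 i2 i3 Bochner_Integration.integrable_diff char_D)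
      also have "(CLINT x|lborel. complex_of_real (f x)) = 1"
        using f_total by simp
      also have "(CLINT x|lborel. \<i> * complex_of_real (t / r n) * complex_of_real (f x * (1 / x))) =
          \<i> * complex_of_real (t / r n) * complex_of_real \<E>"
        unfolding \<E>_eq by (simp only: integral_mult_right_zero integral_complex_of_real)
      finally show ?thesis by simp
    qed
    have "(\<lambda>n. real (Suc n) *\<^sub>R (char D (t / r n) - 1 - \<i> * complex_of_real (t / r n * \<E>))) \<longlonglongrightarrow> \<psi> t"
      unfolding eq r_pow[symmetric] by (rule compensated_integral_tendsto[OF r_top r_pos])
    then have lim: "(\<lambda>n. iexp (- (real (Suc n) * (t / r n * \<E>))) * char D (t / r n) ^ Suc n) \<longlonglongrightarrow> exp (\<psi> t)"
      using assms(9,10) by (intro centered_char_power_tendsto[OF D.real_distribution_axioms r_def] Re_\<psi>_le_0) auto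
    have e1: "real (Suc n) powr (- 1 / \<alpha>) * t = t / r n" for n
      by (simp add: r_def powr_minus_divide)
    have e2: "t * b (Suc n) = real (Suc n) * (t / r n * \<E>)" for n
      by (simp add: b_def r_def powr_diff)
    show ?thesis
      by (rule LIMSEQ_imp_Suc) (simp only: e1 e2 lim)
  qed

  \<comment> \<open>The limit law of the normalised sums of reciprocals\<close>
  define Z where "Z n \<omega> = real n powr (- 1 / \<alpha>) * (\<Sum>i<n. 1 / X i \<omega>) - b n" for n \<omega>
  have Z_meas [measurable]: "random_variable borel (Z n)" for n unfolding Z_def by measurable
  \<comment> \<open>For \<open>n = 0\<close> both sides are 0, since 0 raised by \<open>powr\<close>
    is 0.\<close>
  have Z_eq: "real n powr (1 - 1 / \<alpha>) * (1 / harmonic_mean n (\<lambda>i. X i \<omega>) - \<E>) = Z n \<omega>" for n \<omega>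
  proof (cases "n = 0")
    case False
    then show ?thesis
      by (simp add: harmonic_mean_def Z_def b_def powr_diff powr_minus_divide right_diff_distrib)
  qed (simp add: Z_def b_def)
  have rdZ: "real_distribution (distr M borel (Z n))" for n by (rule real_distribution_distr) simp
  have charZ: "(\<lambda>n. char (distr M borel (Z n)) t) \<longlonglongrightarrow> exp (\<psi> t)" for t
    unfolding Z_def char_affine_iid_sum[OF indep_Y law_Y] by (rule char_lim)
  have "isCont (\<lambda>t. exp (\<psi> t)) 0" by (intro continuous_intros isCont_\<psi>_0)
  then obtain G where G: "real_distribution G" and chG: "char G = (\<lambda>t. exp (\<psi> t))"
    and wc: "weak_conv_m (\<lambda>n. distr M borel (Z n)) G"
    using weak_conv_of_char_limit[OF rdZ charZ] by blast
  interpret G: real_distribution G by (rule G)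
  have chG': "char G s = exp (\<psi> s)" for s by (simp add: chG)
  have atom: "measure G {a} = 0" for a by (rule stable_no_atoms[OF G chG'])
  have "stable_law \<alpha> G"
    by (rule stable_law_of_char_limit[OF _ _ D.real_distribution_axioms G, where b = b])
       (use assms(9,10) atom char_lim in \<open>auto simp: nondegenerate_def chG\<close>)
  moreover obtain C where "0 < C" "((\<lambda>x. x powr \<alpha> * (1 - cdf G x)) \<longlongrightarrow> C) at_top"
    "((\<lambda>x. x powr \<alpha> * cdf G (- x)) \<longlongrightarrow> 0) at_top"
    using stable_tails[OF G chG'] unfolding \<beta>(3) by blast
  ultimately have "unbalanced_stable_law \<alpha> G"
    unfolding unbalanced_stable_law_def using assms(10)
    by (intro conjI exI[of _ C] exI[of _ "1::real"] exI[of _ "0::real"]) auto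

  \<comment> \<open>The limit law of the harmonic mean\<close>
  moreover have "\<exists>N. real_distribution N \<and> (\<forall>x. cdf N x = 1 - cdf G (- x * \<E>\<^sup>2)) \<and>
      weak_conv_m (\<lambda>n. distr M borel
        (\<lambda>\<omega>. real n powr (1 - 1 / \<alpha>) * (harmonic_mean n (\<lambda>i. X i \<omega>) - 1 / \<E>))) N"
  proof (intro exI conjI allI)
    \<comment> \<open>The image of \<open>G\<close> under multiplication by the derivative of the
      reciprocal at \<E>, as the delta method predicts.\<close>
    let ?N = "distr G borel (\<lambda>z. - z / \<E>\<^sup>2)"
    show "real_distribution ?N" by (rule G.real_distribution_distr) simp
    show "cdf ?N x = 1 - cdf G (- x * \<E>\<^sup>2)" for x
    proof -
      define a where "a = - x * \<E>\<^sup>2"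
      have "- z / \<E>\<^sup>2 \<le> x \<longleftrightarrow> a \<le> z" for z
        using \<E>_pos unfolding a_def by (subst pos_divide_le_eq) auto
      then have "cdf ?N x = measure G {a..}"
        by (simp add: cdf_def measure_distr vimage_def atLeast_def)
      \<comment> \<open>The half-line includes \<open>a\<close>, whereas \<open>1 - cdf G a\<close>
        omits it; they agree because \<open>G\<close> has no atoms.\<close>
      also have "{a..} = {a} \<union> (space G - {..a})" by auto
      also have "measure G \<dots> = measure G {a} + measure G (space G - {..a})"
        by (rule G.finite_measure_Union) auto
      also have "\<dots> = 1 - cdf G (- x * \<E>\<^sup>2)"
        unfolding atom by (subst G.prob_compl) (simp_all add: cdf_def a_def)
      finally show ?thesis .
    qed
    let ?\<gamma> = "1 - 1 / \<alpha>"
    let ?g = "\<lambda>n z. real n powr ?\<gamma> * (1 / (\<E> + z * real n powr (- ?\<gamma>)) - 1 / \<E>)"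
    have conv: "weak_conv_m (\<lambda>n. distr (distr M borel (Z n)) borel (?g n)) ?N"
    proof (rule weak_conv_extended_mapping[OF rdZ G wc])
      show "(\<lambda>n. ?g n (zs n)) \<longlonglongrightarrow> - z / \<E>\<^sup>2" if "zs \<longlonglongrightarrow> z" for z zs
        using assms(9) by (intro reciprocal_shift_tendsto[OF \<E>_pos _ that]) simp
    qed measurable
    \<comment> \<open>An identity at every sample point: the reciprocal of the reciprocal of the
      harmonic mean is the mean itself, also where it is 0 by the convention
      \<open>1 / 0 = 0\<close>. For \<open>n = 0\<close> both sides are 0.\<close>
    have gZ: "?g n (Z n \<omega>) = real n powr ?\<gamma> * (harmonic_mean n (\<lambda>i. X i \<omega>) - 1 / \<E>)" for n \<omega>
    proof (cases "n = 0")
      case False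
      then have "real n powr (- ?\<gamma>) * real n powr ?\<gamma> = 1"
        by (subst powr_add[symmetric]) simp
      then have "Z n \<omega> * real n powr (- ?\<gamma>) = 1 / harmonic_mean n (\<lambda>i. X i \<omega>) - \<E>"
        unfolding Z_eq[symmetric] by (simp only: mult.commute[of _ "real n powr (- ?\<gamma>)"] mult.assoc[symmetric] mult_1_left)
      then show ?thesis by simp
    qed simp
    have "distr (distr M borel (Z n)) borel (?g n) =
        distr M borel (\<lambda>\<omega>. real n powr ?\<gamma> * (harmonic_mean n (\<lambda>i. X i \<omega>) - 1 / \<E>))" for n
      by (subst distr_distr) (measurable, simp only: comp_def gZ)
    then show "weak_conv_m (\<lambda>n. distr M borel
        (\<lambda>\<omega>. real n powr ?\<gamma> * (harmonic_mean n (\<lambda>i. X i \<omega>) - 1 / \<E>))) ?N"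
      using conv by (simp only:)
  qed
  ultimately show ?thesis unfolding Z_eq using wc by blast
qed

end
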